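(* For every finite simple graph $G=(V,E)$, the geometric rank of the matching polytope of $G$ is at most $1$.
   Context: The matching polytope $P\subseteq\mathbb{R}^E$ of $G$ is the convex hull of the incidence vectors of matchings of $G$; it is full-dimensional, so $\dim P=|E|$. Let $\mathcal{F}$ be the set of facet-defining inequalities $fx\le f_0$ of $P$ (one for each facet), and for $(f,f_0)\in\mathcal{F}$ let $F_f=\{x\in P: fx=f_0\}$ be the corresponding facet. For $\mathcal{F}_{\min}\subseteq\mathcal{F}$ set $P_{\min}=\{x\in\mathbb{R}^E: fx\le f_0\ \forall(f,f_0)\in\mathcal{F}_{\min}\}$ and, for $(h,h_0)\in\mathcal{F}_{\min}$, let $P^h_{\min}$ be defined likewise using $\mathcal{F}_{\min}\setminus\{(h,h_0)\}$. $\mathcal{F}_{\min}$ is a minimal formulation of $P$ if $P=\mathrm{conv}(P_{\min}\cap\mathbb{Z}^E)$ and, for every $(h,h_0)\in\mathcal{F}_{\min}$, $P\cap\mathbb{Z}^E$ is a proper subset of $P^h_{\min}\cap\mathbb{Z}^E$. Geometric rank (Padberg): $\mathcal{F}_0$ is the set of $(f,f_0)\in\mathcal{F}$ belonging to some minimal formulation of $P$. Given nonempty disjoint families $\mathcal{F}_0,\dots,\mathcal{F}_\rho$ with $\bigcup_{i=0}^{\rho}\mathcal{F}_i\neq\mathcal{F}$, define $\mathcal{F}_{\rho+1}$ as the set of $(f,f_0)\in\mathcal{F}\setminus\bigcup_{i=0}^{\rho}\mathcal{F}_i$ for which there exists $(h,h_0)\in\bigcup_{i=0}^{\rho}\mathcal{F}_i$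 with $\dim(F_f\cap F_h)=\dim P-2$. If $\mathcal{F}=\bigcup_{i=0}^{\rho}\mathcal{F}_i$, then $\rho$ is the geometric rank of $P$. *)

theory Defs
  imports "HOL-Analysis.Analysis"
begin

definition simple_graph :: "'v set \<Rightarrow> 'v set set \<Rightarrow> bool" where
  "simple_graph V E \<longleftrightarrow> finite V \<and> (\<forall>e\<in>E. e \<subseteq> V \<and> card e = 2)"

definition matching :: "'v set set \<Rightarrow> 'v set set \<Rightarrow> bool" where
  "matching E M \<longleftrightarrow> M \<subseteq> E \<and> pairwise disjnt M"

text \<open>
  Since \<open>E\<close> varies as a set (and may be empty), the space of real vectors indexed by a
  set \<open>S\<close> of coordinates is the coordinate subspace of \<open>real ^ 'n\<close> of vectors vanishing
  outside \<open>S\<close>. Inequalities and polyhedra below live in this subspace.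
\<close>

definition coord_space :: "'n::finite set \<Rightarrow> (real ^ 'n) set" where
  "coord_space S = {x. \<forall>i. i \<notin> S \<longrightarrow> x $ i = 0}"

definition integer_points :: "'n::finite set \<Rightarrow> (real ^ 'n) set" where
  "integer_points S = {x \<in> coord_space S. \<forall>i\<in>S. x $ i \<in> \<int>}"

definition incidence_vector :: "'n::finite set \<Rightarrow> real ^ 'n" where
  "incidence_vector M = (\<chi> i. if i \<in> M then 1 else 0)"

definition matching_polytope :: "'v::finite set set \<Rightarrow> (real ^ ('v set)) set" where
  "matching_polytope E = convex hull (incidence_vector ` {M. matching E M})"

text \<open>A pair \<open>(f, f\<^sub>0)\<close> stands for the inequality \<open>f \<bullet> x \<le> f\<^sub>0\<close>.\<close>

type_synonym 'n ineq = "(real ^ 'n) \<times> real"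

definition ineq_face :: "(real ^ 'n::finite) set \<Rightarrow> 'n ineq \<Rightarrow> (real ^ 'n) set" where
  "ineq_face P c = {x \<in> P. fst c \<bullet> x = snd c}"

definition facet_defining :: "'n::finite set \<Rightarrow> (real ^ 'n) set \<Rightarrow> 'n ineq \<Rightarrow> bool" where
  "facet_defining S P c \<longleftrightarrow>
     fst c \<in> coord_space S \<and> (\<forall>x\<in>P. fst c \<bullet> x \<le> snd c) \<and> ineq_face P c facet_of P"

text \<open>
  A facet-defining inequality is determined by its facet only up to positive scaling, so
  a family with exactly one inequality for each facet involves a choice. It is kept as a
  parameter \<open>\<F>\<close>.
\<close>

definition facet_system ::
    "'n::finite set \<Rightarrow> (real ^ 'n) set \<Rightarrow> 'n ineq set \<Rightarrow> bool" where
  "facet_system S P \<F> \<longleftrightarrow>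
     (\<forall>c\<in>\<F>. facet_defining S P c) \<and> bij_betw (ineq_face P) \<F> {K. K facet_of P}"

definition solution_set :: "'n::finite set \<Rightarrow> 'n ineq set \<Rightarrow> (real ^ 'n) set" where
  "solution_set S \<C> = {x \<in> coord_space S. \<forall>c\<in>\<C>. fst c \<bullet> x \<le> snd c}"

definition minimal_formulation ::
    "'n::finite set \<Rightarrow> (real ^ 'n) set \<Rightarrow> 'n ineq set \<Rightarrow> 'n ineq set \<Rightarrow> bool" where
  "minimal_formulation S P \<F> \<M> \<longleftrightarrow>
     \<M> \<subseteq> \<F> \<and>
     P = convex hull (solution_set S \<M> \<inter> integer_points S) \<and>
     (\<forall>h\<in>\<M>. P \<inter> integer_points S \<subset> solution_set S (\<M> - {h}) \<inter> integer_points S)"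

fun rank_family ::
    "'n::finite set \<Rightarrow> (real ^ 'n) set \<Rightarrow> 'n ineq set \<Rightarrow> nat \<Rightarrow> 'n ineq set" where
  "rank_family S P \<F> 0 = {c \<in> \<F>. \<exists>\<M>. minimal_formulation S P \<F> \<M> \<and> c \<in> \<M>}"
| "rank_family S P \<F> (Suc k) =
     {c \<in> \<F> - (\<Union>i\<in>{..k}. rank_family S P \<F> i).
        \<exists>h \<in> (\<Union>i\<in>{..k}. rank_family S P \<F> i).
          aff_dim (ineq_face P c \<inter> ineq_face P h) = aff_dim P - 2}"

text \<open>
  The construction stops as soon as \<open>\<F>\<close> is exhausted, hence the minimality of \<open>\<rho>\<close>. If some
  family is empty before that, all later ones are empty and there is no such \<open>\<rho>\<close>.
\<close>

definition has_geometric_rank ::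
    "'n::finite set \<Rightarrow> (real ^ 'n) set \<Rightarrow> 'n ineq set \<Rightarrow> nat \<Rightarrow> bool" where
  "has_geometric_rank S P \<F> \<rho> \<longleftrightarrow>
     \<F> = (\<Union>i\<in>{..\<rho>}. rank_family S P \<F> i) \<and>
     (\<forall>\<sigma><\<rho>. \<F> \<noteq> (\<Union>i\<in>{..\<sigma>}. rank_family S P \<F> i))"

lemma matching_polytope_subset: "matching_polytope E \<subseteq> coord_space E"
proof -
  have "convex (coord_space E)"
    by (auto simp: convex_def coord_space_def)
  moreover have "incidence_vector ` {M. matching E M} \<subseteq> coord_space E"
    by (auto simp: coord_space_def incidence_vector_def matching_def)
  ultimately show ?thesis
    unfolding matching_polytope_def by (rule hull_minimal[rotated])
qed

lemma facet_system_exists: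
  assumes "polytope P" "P \<subseteq> coord_space S"
  shows "\<exists>\<F>. facet_system S P \<F>"
proof -
  have "\<exists>c. facet_defining S P c \<and> ineq_face P c = K" if K: "K facet_of P" for K
  proof -
    have "K exposed_face_of P"
      using K assms(1) exposed_face_of_polyhedron facet_of_imp_face_of polytope_imp_polyhedron
      by blast
    then obtain a b where ab: "P \<subseteq> {x. a \<bullet> x \<le> b}" "K = P \<inter> {x. a \<bullet> x = b}"
      by (auto simp: exposed_face_of_def)
    define a' :: "real ^ 'a" where "a' = (\<chi> i. if i \<in> S then a $ i else 0)"
    have eq: "a' \<bullet> x = a \<bullet> x" if "x \<in> P" for x
      using that assms(2) by (auto simp: a'_def inner_vec_def coord_space_def intro!: sum.cong)
    have K': "ineq_face P (a', b) = K"
      using eq ab(2) by (auto simp: ineq_face_def)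
    have "a' \<in> coord_space S"
      by (auto simp: a'_def coord_space_def)
    then have "facet_defining S P (a', b)"
      using K K' eq ab(1) by (auto simp: facet_defining_def)
    with K' show ?thesis by blast
  qed
  then obtain g where g: "\<And>K. K facet_of P \<Longrightarrow> facet_defining S P (g K) \<and> ineq_face P (g K) = K"
    by metis
  have "bij_betw (ineq_face P) (g ` {K. K facet_of P}) {K. K facet_of P}"
    using g by (intro bij_betw_byWitness[where f' = g]) auto
  then have "facet_system S P (g ` {K. K facet_of P})"
    using g by (auto simp: facet_system_def)
  then show ?thesis by blast
qed

lemma matching_polytope_facet_system_exists: "\<exists>\<F>. facet_system E (matching_polytope E) \<F>"
proof -
  have "finite (incidence_vector ` {M. matching E M})"
    by simp
  then have "polytope (matching_polytope E)"
    unfolding matching_polytope_def polytope_def by blast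
  then show ?thesis
    by (rule facet_system_exists[OF _ matching_polytope_subset])
qed

end

theory Submission
  imports Defs
begin

text \<open>
  Every integer point outside the polytope violates some inequality of \<open>\<F>\<^sub>0\<close>. The point \<open>- e\<close> violates
  only \<open>x\<^sub>e \<ge> 0\<close>, and the path \<open>{va, vb}\<close> violates only the degree inequality of \<open>v\<close> if \<open>a\<close> and
  \<open>b\<close> are not adjacent; so \<open>\<F>\<^sub>0\<close> contains these facets. A facet \<open>f x \<le> f\<^sub>0\<close> with \<open>f\<^sub>e = 0\<close> is adjacent
  to \<open>x\<^sub>e \<ge> 0\<close>, because deleting \<open>e\<close> from a matching stays on the facet. If \<open>f > 0\<close> and the
  graph is not a star, then by Gallai's lemma the matchings on the facet are the near-perfect
  matchings of a factor-critical graph, and only multiples of the all-ones functional are constant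
  on them. Consider the last step of an ear decomposition of such a graph with proper ears. If
  it adds a single edge \<open>e\<close>, the facet is adjacent to \<open>x\<^sub>e \<ge> 0\<close>; otherwise the first inner
  vertex \<open>v\<close> of the last ear has two nonadjacent neighbours (unless the graph is a triangle), and
  the facet is adjacent to the degree facet of \<open>v\<close>.
\<close>

section \<open>Perfect matchings and ears\<close>

text \<open>Dimensions are computed dually: the dimension of a face is \<open>card E\<close> minus
  the dimension of the space of functionals constant on its matchings. A facet therefore has one
  such functional up to scaling, and two distinct facets are adjacent once their common matchings
  leave at most two independent ones. This is why ears are studied through weights
  \<open>\<alpha>\<close> with a common sum \<open>\<beta>\<close>. The obstacle is the closed ear.
  Attached to a core that already has edges, it creates a cut vertex; the number of matching edges
  on either side is then constant by itself, and rigidity is lost. The last ear must be open unless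
  the core is a single vertex, and this comes from rigidity of the whole graph, which excludes cut
  vertices (\<open>rigid_connected_minus\<close>). No full decomposition is built: among the rigid
  factor-critical cores with edge set different from \<open>E\<close>, one with the most edges is
  chosen, so a single extension reaches \<open>E\<close>. The vertices outside a core must have a
  perfect matching, because ears are found as alternating paths there.\<close>

definition perfect_matching :: "'v set set \<Rightarrow> 'v set \<Rightarrow> 'v set set \<Rightarrow> bool" where
  "perfect_matching E X M \<longleftrightarrow> matching E M \<and> \<Union>M = X"

lemma perfect_matching_empty [simp]: "perfect_matching E {} {}"
  by (simp add: perfect_matching_def matching_def)

lemma perfect_matching_mono:
  "perfect_matching E X M \<Longrightarrow> E \<subseteq> E' \<Longrightarrow> perfect_matching E' X M"
  by (auto simp: perfect_matching_def matching_def)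

lemma perfect_matching_Un:
  assumes "perfect_matching E X M" "perfect_matching E Y N" "X \<inter> Y = {}"
  shows "perfect_matching E (X \<union> Y) (M \<union> N)"
proof -
  have "pairwise disjnt (M \<union> N)"
  proof (rule pairwiseI)
    fix m n
    assume mn: "m \<in> M \<union> N" "n \<in> M \<union> N" "m \<noteq> n"
    have "\<And>m. m \<in> M \<Longrightarrow> m \<subseteq> X" "\<And>n. n \<in> N \<Longrightarrow> n \<subseteq> Y"
      using assms by (auto simp: perfect_matching_def)
    moreover have "pairwise disjnt M" "pairwise disjnt N"
      using assms by (auto simp: perfect_matching_def matching_def)
    ultimately show "disjnt m n"
      using mn assms(3) by (metis UnE disjnt_def disjnt_subset1 disjnt_subset2 disjnt_sym pairwiseD)
  qed
  then show ?thesis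
    using assms by (auto simp: perfect_matching_def matching_def)
qed

lemma perfect_matching_insert:
  assumes "perfect_matching E X M" "{u, v} \<in> E" "u \<notin> X" "v \<notin> X"
  shows "perfect_matching E (insert u (insert v X)) (insert {u, v} M)"
proof -
  have "perfect_matching E {u, v} {{u, v}}"
    using assms(2) by (auto simp: perfect_matching_def matching_def)
  from perfect_matching_Un[OF this assms(1)] show ?thesis
    using assms(3,4) by simp
qed

lemma perfect_matching_remove:
  assumes "perfect_matching E X M" "e \<in> M"
  shows "perfect_matching E (X - e) (M - {e})"
proof -
  have M: "M \<subseteq> E" "pairwise disjnt M" "\<Union>M = X"
    using assms(1) by (auto simp: perfect_matching_def matching_def)
  have "m \<inter> e = {}" if "m \<in> M - {e}" for m
    using that assms(2) M(2) by (auto simp: pairwise_def disjnt_def)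
  then have "\<Union>(M - {e}) = X - e"
    using M(3) assms(2) by blast
  moreover have "pairwise disjnt (M - {e})"
    using M(2) by (rule pairwise_subset) auto
  ultimately show ?thesis
    using M(1) by (auto simp: perfect_matching_def matching_def)
qed

lemma perfect_matching_partner:
  assumes "perfect_matching E X M" "\<forall>e\<in>E. card e = 2" "v \<in> X"
  obtains u where "{v, u} \<in> M" "{v, u} \<in> E" "u \<noteq> v" "u \<in> X"
proof -
  obtain e where e: "e \<in> M" "v \<in> e" "e \<in> E"
    using assms by (auto simp: perfect_matching_def matching_def)
  then obtain u where "e = {v, u}" "u \<noteq> v"
    using assms(2) by (metis card_2_iff' card_2_iff insert_iff singletonD doubleton_eq_iff)
  then show ?thesis
    using that e assms(1) by (auto simp: perfect_matching_def)
qed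

lemma perfect_matching_card:
  fixes M :: "'v::finite set set"
  assumes "perfect_matching E X M" "\<forall>e\<in>E. card e = 2"
  shows "card X = 2 * card M"
proof -
  have "card (\<Union>M) = sum card M"
    using assms by (intro card_Union_disjoint) (auto simp: perfect_matching_def matching_def)
  also have "\<dots> = sum (\<lambda>_. 2) M"
    using assms by (intro sum.cong) (auto simp: perfect_matching_def matching_def)
  finally show ?thesis
    using assms by (simp add: perfect_matching_def)
qed

lemma perfect_matching_sum_Un:
  fixes M :: "'v::finite set set"
  assumes "perfect_matching E X M" "perfect_matching E Y N" "X \<inter> Y = {}"
    and "\<forall>e\<in>E. card e = 2"
  shows "sum \<alpha> (M \<union> N) = sum \<alpha> M + sum \<alpha> N"
proof (rule sum.union_disjoint)
  show "M \<inter> N = {}"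
  proof (rule ccontr)
    assume "M \<inter> N \<noteq> {}"
    then obtain e where e: "e \<in> M" "e \<in> N" by blast
    then have "e \<subseteq> X \<inter> Y" "e \<in> E"
      using assms by (auto simp: perfect_matching_def matching_def)
    with assms(3,4) show False by force
  qed
qed auto

lemma perfect_matching_sum_insert:
  fixes M :: "'v::finite set set"
  assumes "perfect_matching E X M" "u \<notin> X"
  shows "sum \<alpha> (insert {u, v} M) = \<alpha> {u, v} + sum \<alpha> M"
  using assms by (subst sum.insert) (auto simp: perfect_matching_def)

section \<open>Factor-critical graphs, rigidity and matchings of an ear\<close>

definition factor_critical :: "'v set set \<Rightarrow> 'v set \<Rightarrow> bool" where
  "factor_critical E S \<longleftrightarrow> (\<forall>v\<in>S. \<exists>M. perfect_matching E (S - {v}) M)"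

text \<open>For factor-critical graphs, this says that the near-perfect matchings span a facet.\<close>

definition rigid :: "'v set set \<Rightarrow> 'v set \<Rightarrow> bool" where
  "rigid E S \<longleftrightarrow>
     (\<forall>(\<alpha> :: 'v set \<Rightarrow> real) \<beta>.
        (\<forall>v\<in>S. \<forall>M. perfect_matching E (S - {v}) M \<longrightarrow> sum \<alpha> M = \<beta>) \<longrightarrow>
        (\<exists>s. \<forall>e\<in>E. \<alpha> e = s))"

text \<open>
  \<open>ear z c X D\<close>: \<open>D\<close> is the edge set of a path with an odd number of edges from \<open>z\<close> to \<open>c\<close> with
  set of inner vertices \<open>X\<close>; the path may be closed (\<open>z = c\<close>), but none of its proper
  subpaths is.
\<close>

inductive ear :: "'v \<Rightarrow> 'v \<Rightarrow> 'v set \<Rightarrow> 'v set set \<Rightarrow> bool" where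
  edge: "z \<noteq> c \<Longrightarrow> ear z c {} {{z, c}}"
| step: "ear q c X D \<Longrightarrow> q \<noteq> c \<Longrightarrow> p \<notin> insert q (insert c X) \<Longrightarrow> z \<notin> insert p (insert q X) \<Longrightarrow>
    ear z c (insert p (insert q X)) (insert {z, p} (insert {p, q} D))"

lemma ear_vertices:
  assumes "ear z c X D"
  shows "z \<notin> X" "c \<notin> X" "\<Union>D = insert z (insert c X)" "\<forall>e\<in>D. card e = 2"
  using assms by (induction rule: ear.induct) auto

text \<open>The second, fourth, ... edges of the path.\<close>

lemma ear_inner_perfect_matching:
  assumes "ear z c X D"
  shows "\<exists>K. perfect_matching D X K"
  using assms
proof (induction rule: ear.induct)
  case (step q c X D p z)
  then obtain K where "perfect_matching D X K" by blast
  then have "perfect_matching (insert {z, p} (insert {p, q} D)) X K"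
    by (rule perfect_matching_mono) auto
  from perfect_matching_insert[OF this, of p q] show ?case
    using step ear_vertices(1)[OF step(1)] by auto
qed (use perfect_matching_empty in blast)

text \<open>The first, third, ..., last edges of the path; in a closed path they would meet at the
  common endpoint.\<close>

lemma ear_full_perfect_matching:
  assumes "ear z c X D" "z \<noteq> c"
  shows "\<exists>K. perfect_matching D (insert z (insert c X)) K"
  using assms
proof (induction rule: ear.induct)
  case (edge z c)
  from perfect_matching_insert[OF perfect_matching_empty, of z c "{{z, c}}"] show ?case
    by auto
next
  case (step q c X D p z)
  then obtain K where "perfect_matching D (insert q (insert c X)) K" by blast
  then have "perfect_matching (insert {z, p} (insert {p, q} D)) (insert q (insert c X)) K"
    by (rule perfect_matching_mono) auto
  from perfect_matching_insert[OF this, of z p] show ?case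
    using step by (auto simp: insert_commute)
qed

text \<open>The number of inner vertices is even, so deleting \<open>v\<close> leaves an odd number
  of them on exactly one side, and that side takes in its endpoint.\<close>

lemma ear_near_perfect_matching:
  assumes "ear z c X D" "v \<in> X"
  shows "\<exists>K. perfect_matching D (insert z (X - {v})) K \<or> perfect_matching D (insert c (X - {v})) K"
  using assms
proof (induction arbitrary: v rule: ear.induct)
  case (step q c X D p z)
  let ?D = "insert {z, p} (insert {p, q} D)"
  have mono: "perfect_matching D Y K \<Longrightarrow> perfect_matching ?D Y K" for Y K
    by (erule perfect_matching_mono) auto
  have q: "q \<notin> X" "c \<notin> X"
    using ear_vertices[OF step(1)] by auto
  consider "v = p" | "v = q" | "v \<in> X" "v \<noteq> p" "v \<noteq> q"
    using step by blast
  then show ?case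
  proof cases
    case 1
    obtain K where "perfect_matching D (insert q (insert c X)) K"
      using ear_full_perfect_matching[OF step(1,2)] by blast
    moreover have "insert q (insert c X) = insert c (insert p (insert q X) - {v})"
      using 1 step by auto
    ultimately show ?thesis using mono by metis
  next
    case 2
    obtain K where "perfect_matching D X K"
      using ear_inner_perfect_matching[OF step(1)] by blast
    from perfect_matching_insert[OF mono[OF this], of z p]
    have "perfect_matching ?D (insert z (insert p X)) (insert {z, p} K)"
      using step by auto
    moreover have "insert z (insert p X) = insert z (insert p (insert q X) - {v})"
      using 2 step q by auto
    ultimately show ?thesis by metis
  next
    case 3
    then obtain K where
      "perfect_matching D (insert q (X - {v})) K \<or> perfect_matching D (insert c (X - {v})) K"
      using step by blast
    then show ?thesis
    proof
      assume "perfect_matching D (insert q (X - {v})) K"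
      from perfect_matching_insert[OF mono[OF this], of z p]
      have "perfect_matching ?D (insert z (insert p (insert q (X - {v})))) (insert {z, p} K)"
        using step by auto
      moreover have "insert p (insert q (X - {v})) = insert p (insert q X) - {v}"
        using 3 by auto
      ultimately show ?thesis by auto
    next
      assume "perfect_matching D (insert c (X - {v})) K"
      from perfect_matching_insert[OF mono[OF this], of p q]
      have "perfect_matching ?D (insert p (insert q (insert c (X - {v})))) (insert {p, q} K)"
        using step q by auto
      moreover have "insert p (insert q (insert c (X - {v}))) = insert c (insert p (insert q X) - {v})"
        using 3 by auto
      ultimately show ?thesis by metis
    qed
  qed
qed auto

text \<open>The hypotheses are what near-perfect matchings of a larger graph say about an attached
  ear after the rest of their weight is subtracted. Induction peels off \<open>{z, p}\<close> and
  \<open>{p, q}\<close>: these weigh the same, so all three conditions pass to the shorter ear with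
  that weight subtracted from \<open>\<beta>\<close>.\<close>

lemma ear_constant:
  fixes \<alpha> :: "'v::finite set \<Rightarrow> real"
  assumes "ear q c X D" "q \<noteq> c"
    and "\<And>K. perfect_matching D X K \<Longrightarrow> sum \<alpha> K = \<beta>"
    and "\<And>x K. x \<in> X \<Longrightarrow> perfect_matching D (insert q (X - {x})) K \<Longrightarrow> sum \<alpha> K = \<beta>"
    and "\<And>x K. x \<in> X \<Longrightarrow> perfect_matching D (insert c (X - {x})) K \<Longrightarrow> sum \<alpha> K = \<beta>"
  shows "\<exists>s. \<forall>g\<in>D. \<alpha> g = s"
  using assms
proof (induction arbitrary: \<beta> rule: ear.induct)
  case (step q c X D p z)
  let ?X = "insert p (insert q X)" and ?D = "insert {z, p} (insert {p, q} D)"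
  have mono: "perfect_matching D Y K \<Longrightarrow> perfect_matching ?D Y K" for Y K
    by (erule perfect_matching_mono) auto
  have q: "q \<notin> X" "c \<notin> X" and card2: "\<forall>e\<in>D. card e = 2"
    using ear_vertices[OF step(1)] by auto
  have pq: "sum \<alpha> (insert {p, q} K) = \<alpha> {p, q} + sum \<alpha> K" and
       zp: "sum \<alpha> (insert {z, p} K) = \<alpha> {z, p} + sum \<alpha> K"
    if "perfect_matching D Y K" "p \<notin> Y" for Y K
    using that perfect_matching_sum_insert[OF that, of \<alpha> q] perfect_matching_sum_insert[OF that, of \<alpha> z]
    by (auto simp: insert_commute)
  have inner: "\<alpha> {p, q} + sum \<alpha> K = \<beta>" if "perfect_matching D X K" for K
    using perfect_matching_insert[OF mono[OF that], of p q] step q pq[OF that]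
    by (metis insertCI)
  have inner': "\<alpha> {z, p} + sum \<alpha> K = \<beta>" if "perfect_matching D X K" for K
  proof -
    have "perfect_matching ?D (insert z (insert p X)) (insert {z, p} K)"
      using perfect_matching_insert[OF mono[OF that], of z p] step by auto
    moreover have "insert z (insert p X) = insert z (?X - {q})"
      using step q by auto
    ultimately have "sum \<alpha> (insert {z, p} K) = \<beta>"
      using step.prems(3)[of q] by auto
    then show ?thesis using zp[OF that] step by auto
  qed
  obtain N where N: "perfect_matching D X N"
    using ear_inner_perfect_matching[OF step(1)] by blast
  \<comment> \<open>Both edges complete the same \<open>N\<close>: \<open>{p, q}\<close> when no
    inner vertex is missed, \<open>{z, p}\<close> when \<open>q\<close> is missed.\<close>
  have eq: "\<alpha> {z, p} = \<alpha> {p, q}"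
    using inner[OF N] inner'[OF N] by simp
  have "\<exists>s. \<forall>g\<in>D. \<alpha> g = s"
  proof (rule step.IH[OF step(2)])
    show "sum \<alpha> K = \<beta> - \<alpha> {p, q}" if "perfect_matching D X K" for K
      using inner[OF that] by simp
    show "sum \<alpha> K = \<beta> - \<alpha> {p, q}"
      if x: "x \<in> X" and K: "perfect_matching D (insert q (X - {x})) K" for x K
    proof -
      have "perfect_matching ?D (insert z (insert p (insert q (X - {x})))) (insert {z, p} K)"
        using perfect_matching_insert[OF mono[OF K], of z p] step by auto
      moreover have "insert p (insert q (X - {x})) = ?X - {x}"
        using x step q by auto
      ultimately have "sum \<alpha> (insert {z, p} K) = \<beta>"
        using step.prems(3)[of x] x by auto
      then show ?thesis using zp[OF K] eq step by auto
    qed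
    show "sum \<alpha> K = \<beta> - \<alpha> {p, q}"
      if x: "x \<in> X" and K: "perfect_matching D (insert c (X - {x})) K" for x K
    proof -
      have "perfect_matching ?D (insert p (insert q (insert c (X - {x})))) (insert {p, q} K)"
        using perfect_matching_insert[OF mono[OF K], of p q] step q by auto
      moreover have "insert p (insert q (insert c (X - {x}))) = insert c (?X - {x})"
        using x step q by auto
      ultimately have "sum \<alpha> (insert {p, q} K) = \<beta>"
        using step.prems(4)[of x] x by auto
      then show ?thesis using pq[OF K] step by auto
    qed
  qed
  then obtain s where s: "\<And>g. g \<in> D \<Longrightarrow> \<alpha> g = s" by blast
  obtain J where J: "perfect_matching D (insert q (insert c X)) J"
    using ear_full_perfect_matching[OF step(1,2)] by blast
  \<comment> \<open>The matching \<open>J\<close>, which misses \<open>p\<close>, weighs as much as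
    \<open>N\<close> with \<open>{p, q}\<close>. It has one edge more than \<open>N\<close>, so
    \<open>{p, q}\<close> weighs \<open>s\<close>.\<close>
  have "insert q (insert c X) = insert c (?X - {p})"
    using step by auto
  then have "sum \<alpha> J = \<beta>"
    using step.prems(4)[of p J] mono[OF J] by auto
  moreover have sub: "J \<subseteq> D" "N \<subseteq> D"
    using J N by (auto simp: perfect_matching_def matching_def)
  have "sum \<alpha> J = real (card J) * s" "sum \<alpha> N = real (card N) * s"
    using sub s by (auto simp: subset_iff)
  moreover have "card J = card N + 1"
    using perfect_matching_card[OF J card2] perfect_matching_card[OF N card2] q step(2)
    by auto
  ultimately have "\<alpha> {p, q} = s"
    using inner[OF N] by (simp add: algebra_simps)
  then show ?case using s eq by auto
qed auto

text \<open>Follow the path alternating between \<open>N\<close> and \<open>M\<close> from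
  \<open>y\<close>, the vertex missed by \<open>M\<close>. Every vertex of \<open>Y\<close> is
  covered by \<open>N\<close>, and every one but \<open>y\<close> by \<open>M\<close>, so the path
  cannot stop in \<open>Y\<close> and steps into \<open>C\<close> along an edge of \<open>M\<close>.
  With \<open>{z, y}\<close> in front it has an odd number of edges, and \<open>N\<close> still
  matches the rest of \<open>Y\<close>.\<close>

lemma alternating_ear:
  fixes E :: "'v::finite set set"
  assumes "perfect_matching E Y N" "perfect_matching E ((C \<union> Y) - {y}) M" "C \<inter> Y = {}"
    and "y \<in> Y" "{z, y} \<in> E" "z \<notin> Y" "\<forall>e\<in>E. card e = 2"
  shows "\<exists>c\<in>C. \<exists>X D N'. X \<subseteq> Y \<and> y \<in> X \<and> D \<subseteq> E \<and> ear z c X D \<and> perfect_matching E (Y - X) N'"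
  using assms
proof (induction "card Y" arbitrary: Y N M y z rule: less_induct)
  case less
  obtain y1 where y1: "{y, y1} \<in> N" "{y, y1} \<in> E" "y1 \<noteq> y" "y1 \<in> Y"
    using perfect_matching_partner[OF less.prems(1) less.prems(7,4)] by blast
  then have "y1 \<in> (C \<union> Y) - {y}" by auto
  from perfect_matching_partner[OF less.prems(2,7) this]
  obtain y2 where y2: "{y1, y2} \<in> M" "{y1, y2} \<in> E" "y2 \<noteq> y1" "y2 \<in> (C \<union> Y) - {y}"
    by blast
  let ?Y = "Y - {y, y1}"
  have N1: "perfect_matching E ?Y (N - {{y, y1}})"
    using perfect_matching_remove[OF less.prems(1) y1(1)] .
  show ?case
  proof (cases "y2 \<in> C")
    case True
    have "ear z y2 {y, y1} (insert {z, y} (insert {y, y1} {{y1, y2}}))"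
      using y1 y2 True less.prems by (intro ear.step ear.edge) auto
    moreover have "{y, y1} \<subseteq> Y" "insert {z, y} (insert {y, y1} {{y1, y2}}) \<subseteq> E"
      using y1 y2 less.prems by auto
    ultimately show ?thesis using True N1 by blast
  next
    case False
    \<comment> \<open>The situation recurs two vertices further on: \<open>y1\<close> plays
      \<open>z\<close>, and \<open>y2\<close>, deprived of its edge of \<open>M\<close>, plays
      \<open>y\<close>.\<close>
    have M1: "perfect_matching E ((C \<union> ?Y) - {y2}) (M - {{y1, y2}})"
    proof -
      have "(C \<union> Y) - {y} - {y1, y2} = (C \<union> ?Y) - {y2}"
        using y1 less.prems by auto
      with perfect_matching_remove[OF less.prems(2) y2(1)] show ?thesis by simp
    qed
    have "card ?Y < card Y"
      using y1 by (intro psubset_card_mono) auto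
    moreover have "C \<inter> ?Y = {}"
      using less.prems(3) by auto
    ultimately have "\<exists>c\<in>C. \<exists>X D N'. X \<subseteq> ?Y \<and> y2 \<in> X \<and> D \<subseteq> E \<and> ear y1 c X D \<and> perfect_matching E (?Y - X) N'"
      using less.hyps[OF _ N1 M1, of y1] y1 y2 False less.prems(7) by blast
    then obtain c X D N' where X: "c \<in> C" "X \<subseteq> ?Y" "y2 \<in> X" "D \<subseteq> E" "ear y1 c X D"
      "perfect_matching E (?Y - X) N'"
      by blast
    have "ear z c (insert y (insert y1 X)) (insert {z, y} (insert {y, y1} D))"
      using X y1 y2 less.prems by (intro ear.step) auto
    moreover have "?Y - X = Y - insert y (insert y1 X)" by auto
    moreover have "insert y (insert y1 X) \<subseteq> Y" "insert {z, y} (insert {y, y1} D) \<subseteq> E"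
      using X y1 less.prems by auto
    ultimately show ?thesis using X(1,6) by (metis insertI1)
  qed
qed

lemma factor_critical_mono: "factor_critical E S \<Longrightarrow> E \<subseteq> E' \<Longrightarrow> factor_critical E' S"
  by (meson factor_critical_def perfect_matching_mono)

text \<open>If \<open>v\<close> is old, the inner vertices are matched among themselves. If
  \<open>v\<close> is inner, the ear absorbs one endpoint \<open>u\<close>, and the old graph is
  matched without \<open>u\<close>. The ear may be closed.\<close>

lemma factor_critical_ear:
  assumes "factor_critical E S" "ear z c X D" "z \<in> S" "c \<in> S" "X \<inter> S = {}"
  shows "factor_critical (E \<union> D) (S \<union> X)"
  unfolding factor_critical_def
proof
  have monoE: "perfect_matching E Y K \<Longrightarrow> perfect_matching (E \<union> D) Y K"
   and monoD: "perfect_matching D Y K \<Longrightarrow> perfect_matching (E \<union> D) Y K" for Y K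
    by (auto elim: perfect_matching_mono)
  fix v assume v: "v \<in> S \<union> X"
  show "\<exists>M. perfect_matching (E \<union> D) (S \<union> X - {v}) M"
  proof (cases "v \<in> S")
    case True
    then obtain M where M: "perfect_matching E (S - {v}) M"
      using assms by (auto simp: factor_critical_def)
    obtain K where K: "perfect_matching D X K"
      using ear_inner_perfect_matching[OF assms(2)] by blast
    have "perfect_matching (E \<union> D) ((S - {v}) \<union> X) (M \<union> K)"
      using perfect_matching_Un[OF monoE[OF M] monoD[OF K]] assms by auto
    moreover have "(S - {v}) \<union> X = S \<union> X - {v}"
      using True assms by auto
    ultimately show ?thesis by auto
  next
    case False
    with v have "v \<in> X" by auto
    with ear_near_perfect_matching[OF assms(2)] assms(3,4)
    obtain u K where K: "u \<in> S" "perfect_matching D (insert u (X - {v})) K"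
      by metis
    then obtain M where M: "perfect_matching E (S - {u}) M"
      using assms by (auto simp: factor_critical_def)
    have "perfect_matching (E \<union> D) ((S - {u}) \<union> insert u (X - {v})) (M \<union> K)"
      using perfect_matching_Un[OF monoE[OF M] monoD[OF K(2)]] assms by auto
    moreover have "(S - {u}) \<union> insert u (X - {v}) = S \<union> X - {v}"
      using K False by auto
    ultimately show ?thesis by auto
  qed
qed

section \<open>Connectivity from parity and from rigidity\<close>

text \<open>If no edge left \<open>X\<close>, every near-perfect matching would pair off
  \<open>X - {v}\<close>, and the size of this set would be even both for \<open>v\<close> in
  \<open>X\<close> and for \<open>v\<close> outside.\<close>

lemma factor_critical_connected:
  fixes E :: "'v::finite set set"
  assumes fc: "factor_critical E S" and card2: "\<forall>e\<in>E. card e = 2"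
    and X: "X \<subseteq> S" "X \<noteq> {}" "X \<noteq> S"
  shows "\<exists>e\<in>E. e \<inter> X \<noteq> {} \<and> e \<inter> (S - X) \<noteq> {}"
proof (rule ccontr)
  assume no: "\<not> ?thesis"
  have ev: "even (card (X - {v}))" if v: "v \<in> S" for v
  proof -
    obtain M where M: "perfect_matching E (S - {v}) M"
      using fc v by (auto simp: factor_critical_def)
    let ?M = "{e \<in> M. e \<inter> X \<noteq> {}}"
    have "\<Union>?M = X - {v}"
    proof
      show "\<Union>?M \<subseteq> X - {v}"
      proof
        fix x assume "x \<in> \<Union>?M"
        then obtain e where e: "e \<in> M" "e \<inter> X \<noteq> {}" "x \<in> e" by auto
        then have "e \<in> E" "x \<in> S - {v}"
          using M by (auto simp: perfect_matching_def matching_def)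
        with no e show "x \<in> X - {v}" by auto
      qed
      show "X - {v} \<subseteq> \<Union>?M"
      proof
        fix x assume x: "x \<in> X - {v}"
        then have "x \<in> \<Union>M" using M X(1) by (auto simp: perfect_matching_def)
        with x show "x \<in> \<Union>?M" by auto
      qed
    qed
    then have "perfect_matching E (X - {v}) ?M"
      using M by (auto simp: perfect_matching_def matching_def intro: pairwise_subset)
    from perfect_matching_card[OF this card2] show ?thesis by simp
  qed
  obtain x y where x: "x \<in> X" and y: "y \<in> S - X"
    using X by auto
  from ev[of x] ev[of y] x y X(1) show False
    by (auto simp: card_Diff_singleton_if card_gt_0_iff)
qed

text \<open>Otherwise \<open>a\<close> separates \<open>X\<close> from the rest. Then all
  near-perfect matchings have the same number of edges meeting \<open>X\<close>, although some edges
  meet \<open>X\<close> and some do not; this contradicts rigidity. So there is no cut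
  vertex.\<close>

lemma rigid_connected_minus:
  fixes E :: "'v::finite set set"
  assumes fc: "factor_critical E S" and rigid: "rigid E S" and card2: "\<forall>e\<in>E. card e = 2"
    and ES: "\<Union>E \<subseteq> S" and a: "a \<in> S" and X: "X \<subseteq> S - {a}" "X \<noteq> {}" "X \<noteq> S - {a}"
  shows "\<exists>e\<in>E. e \<inter> X \<noteq> {} \<and> e \<inter> (S - {a} - X) \<noteq> {}"
proof (rule ccontr)
  assume no: "\<not> ?thesis"
  define \<alpha> :: "'v set \<Rightarrow> real" where "\<alpha> e = (if e \<inter> X = {} then 0 else 1)" for e
  let ?r = "\<lambda>M. {e \<in> M. e \<inter> X \<noteq> {}}"
  have sum: "sum \<alpha> M = real (card (?r M))" for M
    by (simp add: \<alpha>_def sum.If_cases Int_def)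
  have restr: "perfect_matching E (\<Union>(?r M)) (?r M)" "X - {v} \<subseteq> \<Union>(?r M)"
      "\<Union>(?r M) \<subseteq> insert a X - {v}"
    if "perfect_matching E (S - {v}) M" for v M
  proof -
    have M: "M \<subseteq> E" "pairwise disjnt M" "\<Union>M = S - {v}"
      using that by (auto simp: perfect_matching_def matching_def)
    then show "perfect_matching E (\<Union>(?r M)) (?r M)"
      by (auto simp: perfect_matching_def matching_def intro: pairwise_subset)
    show "X - {v} \<subseteq> \<Union>(?r M)"
    proof
      fix x assume x: "x \<in> X - {v}"
      then have "x \<in> \<Union>M" using M(3) X(1) by auto
      with x show "x \<in> \<Union>(?r M)" by auto
    qed
    show "\<Union>(?r M) \<subseteq> insert a X - {v}"
    proof
      fix x assume "x \<in> \<Union>(?r M)"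
      then obtain e where e: "e \<in> M" "e \<inter> X \<noteq> {}" "x \<in> e" by auto
      then have "e \<in> E" "x \<in> S - {v}"
        using M by auto
      with no e show "x \<in> insert a X - {v}" by auto
    qed
  qed
  have aX: "a \<notin> X" using X by auto
  obtain Ma where Ma: "perfect_matching E (S - {a}) Ma"
    using fc a by (auto simp: factor_critical_def)
  have "\<Union>(?r Ma) = X"
    using restr(2,3)[OF Ma] aX by auto
  then have evX: "even (card X)"
    using perfect_matching_card[OF restr(1)[OF Ma] card2] by simp
  have "sum \<alpha> M = real (card X div 2)" if M: "perfect_matching E (S - {v}) M" for v M
  proof -
    have ev: "even (card (\<Union>(?r M)))"
      using perfect_matching_card[OF restr(1)[OF M] card2] by simp
    \<comment> \<open>The edges meeting \<open>X\<close> cover \<open>X - {v}\<close> and possibly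
      \<open>a\<close>. Since \<open>card X\<close> and the number of covered vertices are even,
      only \<open>card X\<close> is possible.\<close>
    have "card (\<Union>(?r M)) = card X"
    proof (cases "v \<in> X")
      case True
      then have cX: "card (X - {v}) = card X - 1" "card X > 0"
        by (auto simp: card_gt_0_iff)
      have "card (X - {v}) \<le> card (\<Union>(?r M))"
        using restr(2)[OF M] by (intro card_mono) auto
      moreover have "card (\<Union>(?r M)) \<le> card (insert a X - {v})"
        using restr(3)[OF M] by (intro card_mono) auto
      moreover have "card (insert a X - {v}) = card X"
        using True aX cX by (simp add: card_Diff_singleton_if)
      ultimately have "card (\<Union>(?r M)) = card X - 1 \<or> card (\<Union>(?r M)) = card X"
        using cX by linarith
      with ev evX cX show ?thesis by auto
    next
      case False
      have "card X \<le> card (\<Union>(?r M))"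
        using restr(2)[OF M] False by (intro card_mono) auto
      moreover have "card (\<Union>(?r M)) \<le> card (insert a X)"
        using restr(3)[OF M] by (intro card_mono) auto
      ultimately have "card (\<Union>(?r M)) = card X \<or> card (\<Union>(?r M)) = card X + 1"
        using aX by simp linarith
      with ev evX show ?thesis by auto
    qed
    then show ?thesis
      using perfect_matching_card[OF restr(1)[OF M] card2] sum by simp
  qed
  then obtain s where s: "\<And>e. e \<in> E \<Longrightarrow> \<alpha> e = s"
    using rigid unfolding rigid_def by metis
  obtain x where x: "x \<in> X" using X by auto
  obtain y where y: "y \<in> S - {a} - X" using X by auto
  have "x \<in> \<Union>Ma" "y \<in> \<Union>Ma" "Ma \<subseteq> E"
    using x y X(1) Ma by (auto simp: perfect_matching_def matching_def)
  then obtain e g where e: "e \<in> Ma" "e \<in> E" "x \<in> e" and g: "g \<in> Ma" "g \<in> E" "y \<in> g"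
    by blast
  have "\<alpha> e = 1" using e x by (auto simp: \<alpha>_def)
  moreover have "\<alpha> g = 0" using g y no by (auto simp: \<alpha>_def)
  ultimately show False using s e g by force
qed

section \<open>Rigidity after adding an edge or an ear\<close>

text \<open>In a matching that misses \<open>u\<close>, exchanging the edge \<open>{v, w}\<close>
  for \<open>g = {u, v}\<close> gives a matching that misses \<open>w\<close>, so \<open>g\<close>
  weighs as much as \<open>{v, w}\<close>.\<close>

lemma rigid_insert:
  fixes E :: "'v::finite set set"
  assumes fc: "factor_critical E S" and rigid: "rigid E S" and card2: "\<forall>e\<in>insert g E. card e = 2"
    and g: "g \<subseteq> S"
  shows "rigid (insert g E) S"
  unfolding rigid_def
proof (intro allI impI)
  fix \<alpha> :: "'v set \<Rightarrow> real" and \<beta>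
  assume eq: "\<forall>v\<in>S. \<forall>M. perfect_matching (insert g E) (S - {v}) M \<longrightarrow> sum \<alpha> M = \<beta>"
  have mono: "perfect_matching E Y K \<Longrightarrow> perfect_matching (insert g E) Y K" for Y K
    by (erule perfect_matching_mono) auto
  obtain s where s: "\<And>e. e \<in> E \<Longrightarrow> \<alpha> e = s"
    using rigid eq mono unfolding rigid_def by metis
  obtain u v where uv: "g = {u, v}" "u \<noteq> v"
    using card2 by (auto simp: card_2_iff)
  then have uvS: "u \<in> S" "v \<in> S" using g by auto
  then obtain M where M: "perfect_matching E (S - {u}) M"
    using fc by (auto simp: factor_critical_def)
  obtain w where w: "{v, w} \<in> M" "{v, w} \<in> E" "w \<noteq> v" "w \<in> S - {u}"
    using perfect_matching_partner[OF M, of v] card2 uv uvS by auto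
  have M': "perfect_matching E (S - {u} - {v, w}) (M - {{v, w}})"
    using perfect_matching_remove[OF M w(1)] .
  have "perfect_matching (insert g E) (insert u (insert v (S - {u} - {v, w}))) (insert g (M - {{v, w}}))"
    using perfect_matching_insert[OF mono[OF M'], of u v] uv by simp
  moreover have "insert u (insert v (S - {u} - {v, w})) = S - {w}"
    using uvS w by auto
  ultimately have "sum \<alpha> (insert g (M - {{v, w}})) = \<beta>"
    using eq[rule_format, of w] w(4) by (metis DiffD1)
  moreover have "sum \<alpha> (insert g (M - {{v, w}})) = \<alpha> g + sum \<alpha> (M - {{v, w}})"
    using perfect_matching_sum_insert[OF M', of u \<alpha> v] uv by simp
  moreover have "sum \<alpha> M = \<beta>"
    using eq mono[OF M] uvS by auto
  moreover have "sum \<alpha> M = \<alpha> {v, w} + sum \<alpha> (M - {{v, w}})"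
    using w(1) by (simp add: sum.remove)
  ultimately have "\<alpha> g = s" using s w by simp
  with s show "\<exists>s. \<forall>e\<in>insert g E. \<alpha> e = s" by auto
qed

text \<open>
  The ear is \<open>z - p - q - \<dots> - c\<close>. Only the matchings covering \<open>p\<close> are considered, so the value on
  the two edges at \<open>p\<close> may differ from \<open>s\<close>: this is the degree equation of \<open>p\<close>.
\<close>

lemma ear_degree_equation:
  fixes E :: "'v::finite set set" and \<alpha> :: "'v set \<Rightarrow> real"
  assumes fc: "factor_critical E S" and rigid: "rigid E S" and card2: "\<forall>e\<in>E. card e = 2"
    and ES: "\<Union>E \<subseteq> S"
    and ear: "ear q c X D" "q \<noteq> c" "p \<notin> insert q (insert c X)" "z \<notin> insert p (insert q X)"
    and zc: "z \<in> S" "c \<in> S" "insert p (insert q X) \<inter> S = {}" "z \<noteq> c \<or> S = {z}"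
    and eq: "\<And>v M. v \<in> S \<union> insert p (insert q X) \<Longrightarrow> v \<noteq> p \<Longrightarrow>
      perfect_matching (E \<union> insert {z, p} (insert {p, q} D)) (S \<union> insert p (insert q X) - {v}) M \<Longrightarrow>
      sum \<alpha> M = \<beta>"
  shows "\<exists>s. (\<forall>g\<in>E \<union> D. \<alpha> g = s) \<and> \<alpha> {z, p} = \<alpha> {p, q} \<and>
    \<beta> = \<alpha> {p, q} + real (card (S \<union> X) div 2) * s"
proof -
  let ?X = "insert p (insert q X)"
  let ?E = "E \<union> insert {z, p} (insert {p, q} D)" and ?S = "S \<union> ?X"
  have monoE: "perfect_matching E Y K \<Longrightarrow> perfect_matching ?E Y K"
   and monoD: "perfect_matching D Y K \<Longrightarrow> perfect_matching ?E Y K" for Y K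
    by (auto elim: perfect_matching_mono)
  have q: "q \<notin> X" "c \<notin> X" "\<forall>e\<in>D. card e = 2"
    using ear_vertices[OF ear(1)] by auto
  have card2': "\<forall>e\<in>?E. card e = 2"
    using card2 q ear by auto
  have disj: "p \<notin> S" "q \<notin> S" "X \<inter> S = {}" "p \<notin> X" "p \<noteq> q" "z \<noteq> p" "z \<noteq> q" "z \<notin> X" "p \<noteq> c"
    using zc ear by auto
  obtain N where N: "perfect_matching D X N"
    using ear_inner_perfect_matching[OF ear(1)] by blast
  \<comment> \<open>\<open>pq\<close> and \<open>zp\<close> are the two ways of matching
    \<open>p\<close>; the remaining edges split into a part \<open>L\<close> in the core and a part
    \<open>K\<close> in the ear from \<open>q\<close> to \<open>c\<close>.\<close>
  have pq: "\<alpha> {p, q} + sum \<alpha> L + sum \<alpha> K = \<beta>"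
    if "v \<in> S \<union> X" "perfect_matching E A L" "perfect_matching D B K" "A \<inter> B = {}" "p \<notin> A" "p \<notin> B" "q \<notin> A" "q \<notin> B"
      "insert p (insert q (A \<union> B)) = ?S - {v}" for v A B L K
  proof -
    have 1: "perfect_matching ?E (A \<union> B) (L \<union> K)"
      using perfect_matching_Un[OF monoE monoD] that by auto
    have "perfect_matching ?E (?S - {v}) (insert {p, q} (L \<union> K))"
      using perfect_matching_insert[OF 1, of p q] that by auto
    from eq[OF _ _ this] have "sum \<alpha> (insert {p, q} (L \<union> K)) = \<beta>"
      using that disj by auto
    then show ?thesis
      using perfect_matching_sum_insert[OF 1, of p \<alpha> q] that
        perfect_matching_sum_Un[OF monoE[OF that(2)] monoD[OF that(3)] that(4) card2', of \<alpha>]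
      by auto
  qed
  have zp: "\<alpha> {z, p} + sum \<alpha> L + sum \<alpha> K = \<beta>"
    if "v \<in> insert q (S \<union> X)" "perfect_matching E A L" "perfect_matching D B K" "A \<inter> B = {}"
      "p \<notin> A" "p \<notin> B" "z \<notin> A" "z \<notin> B"
      "insert z (insert p (A \<union> B)) = ?S - {v}" for v A B L K
  proof -
    have 1: "perfect_matching ?E (A \<union> B) (L \<union> K)"
      using perfect_matching_Un[OF monoE monoD] that by auto
    have "perfect_matching ?E (?S - {v}) (insert {z, p} (L \<union> K))"
      using perfect_matching_insert[OF 1, of z p] that by auto
    from eq[OF _ _ this] have "sum \<alpha> (insert {z, p} (L \<union> K)) = \<beta>"
      using that disj by auto
    then show ?thesis
      using perfect_matching_sum_insert[OF 1, of z \<alpha> p] that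
        perfect_matching_sum_Un[OF monoE[OF that(2)] monoD[OF that(3)] that(4) card2', of \<alpha>]
      by auto
  qed
  have "sum \<alpha> M = \<beta> - \<alpha> {p, q} - sum \<alpha> N" if "v \<in> S" "perfect_matching E (S - {v}) M" for v M
  proof -
    have "\<alpha> {p, q} + sum \<alpha> M + sum \<alpha> N = \<beta>"
      by (rule pq[of v, OF _ that(2) N]) (use that(1) disj q(1) in auto)
    then show ?thesis by simp
  qed
  with rigid obtain s where s: "\<And>e. e \<in> E \<Longrightarrow> \<alpha> e = s"
    unfolding rigid_def by metis
  define m where "m = real (card S div 2)"
  have near: "sum \<alpha> L = m * s" if "perfect_matching E (S - {v}) L" "v \<in> S" for v L
  proof -
    have "card S = Suc (2 * card L)"
      using perfect_matching_card[OF that(1) card2] that(2) by (metis card_Suc_Diff1 finite)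
    moreover have "L \<subseteq> E"
      using that by (auto simp: perfect_matching_def matching_def)
    ultimately show ?thesis
      using s by (simp add: m_def subset_iff)
  qed
  obtain Mz where Mz: "perfect_matching E (S - {z}) Mz"
    using fc zc by (auto simp: factor_critical_def)
  obtain Mc where Mc: "perfect_matching E (S - {c}) Mc"
    using fc zc by (auto simp: factor_critical_def)
  \<comment> \<open>The same \<open>Mz\<close> and \<open>N\<close> are completed twice: with
    \<open>{z, p}\<close> they miss \<open>q\<close>, with \<open>{p, q}\<close> they miss
    \<open>z\<close>.\<close>
  have "\<alpha> {z, p} + m * s + sum \<alpha> N = \<beta>"
  proof -
    have "\<alpha> {z, p} + sum \<alpha> Mz + sum \<alpha> N = \<beta>"
      by (rule zp[of q, OF _ Mz N]) (use zc(1) disj q(1) in auto)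
    then show ?thesis using near[OF Mz zc(1)] by simp
  qed
  moreover have 2: "\<alpha> {p, q} + m * s + sum \<alpha> N = \<beta>"
  proof -
    have "\<alpha> {p, q} + sum \<alpha> Mz + sum \<alpha> N = \<beta>"
      by (rule pq[of z, OF _ Mz N]) (use zc(1) disj q(1) in auto)
    then show ?thesis using near[OF Mz zc(1)] by simp
  qed
  ultimately have t: "\<alpha> {z, p} = \<alpha> {p, q}" by simp
  \<comment> \<open>Seen from the ear between \<open>q\<close> and \<open>c\<close>, the rest of the
    matching contributes a fixed amount: \<open>m * s\<close> from the core, and one of the two
    equally heavy edges at \<open>p\<close>.\<close>
  have "\<exists>r. \<forall>g\<in>D. \<alpha> g = r"
  proof (rule ear_constant[OF ear(1,2)])
    show "sum \<alpha> K = \<beta> - \<alpha> {p, q} - m * s" if "perfect_matching D X K" for K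
    proof -
      have "\<alpha> {p, q} + sum \<alpha> Mz + sum \<alpha> K = \<beta>"
        by (rule pq[of z, OF _ Mz that]) (use zc(1) disj q(1) in auto)
      then show ?thesis using near[OF Mz zc(1)] by simp
    qed
    show "sum \<alpha> K = \<beta> - \<alpha> {p, q} - m * s"
      if x: "x \<in> X" and K: "perfect_matching D (insert q (X - {x})) K" for x K
    proof -
      have "\<alpha> {z, p} + sum \<alpha> Mz + sum \<alpha> K = \<beta>"
        by (rule zp[of x, OF _ Mz K]) (use zc(1) disj q(1) x in auto)
      then show ?thesis using near[OF Mz zc(1)] t by simp
    qed
    show "sum \<alpha> K = \<beta> - \<alpha> {p, q} - m * s"
      if x: "x \<in> X" and K: "perfect_matching D (insert c (X - {x})) K" for x K
    proof -
      have "\<alpha> {p, q} + sum \<alpha> Mc + sum \<alpha> K = \<beta>"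
        by (rule pq[of x, OF _ Mc K]) (use zc(2) disj q(1) x ear(2) in auto)
      then show ?thesis using near[OF Mc zc(2)] by simp
    qed
  qed
  then obtain r where r: "\<And>g. g \<in> D \<Longrightarrow> \<alpha> g = r" by blast
  have cardX: "card X = 2 * card N"
    using perfect_matching_card[OF N q(3)] .
  have sumN: "sum \<alpha> N = real (card X div 2) * r"
    using N r cardX by (auto simp: perfect_matching_def matching_def subset_iff)
  have odd: "odd (card S)"
    using perfect_matching_card[OF Mz card2] zc by (metis card_Suc_Diff1 even_Suc dvd_triv_left finite)
  have cardSX: "card (S \<union> X) div 2 = card S div 2 + card X div 2"
    using disj cardX by (subst card_Un_disjoint) (auto simp: Int_commute)
  show ?thesis
  proof (cases "E = {}")
    \<comment> \<open>The core is a single vertex. No core edge fixes \<open>s\<close>, so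
      \<open>r\<close> is taken for it.\<close>
    case True
    obtain b where "S = {b}"
    proof -
      from Mz True have "Mz = {}" by (auto simp: perfect_matching_def matching_def)
      with Mz have "S - {z} = {}" by (auto simp: perfect_matching_def)
      with zc that show ?thesis by blast
    qed
    then have "m = 0" by (simp add: m_def)
    then show ?thesis
      using True r t 2 sumN cardSX \<open>S = {b}\<close> by (intro exI[of _ r]) auto
  next
    case False
    have "z \<noteq> c"
    proof
      assume "z = c"
      with zc have "S = {z}" by auto
      obtain e where e: "e \<in> E" using False by auto
      then have "e \<subseteq> {z}" using ES \<open>S = {z}\<close> by auto
      then have "card e \<le> 1" using card_mono[of "{z}" e] by simp
      with e card2 show False by auto
    qed
    \<comment> \<open>The ear is open, so \<open>c\<close> can be handed over to it: missing
      \<open>w\<close> instead of \<open>q\<close> costs one core edge of weight \<open>s\<close>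
      and gains one ear edge of weight \<open>r\<close>.\<close>
    then obtain w where w: "{c, w} \<in> Mz" "{c, w} \<in> E" "w \<noteq> c" "w \<in> S - {z}"
      using perfect_matching_partner[OF Mz card2, of c] zc by blast
    have M': "perfect_matching E (S - {z} - {c, w}) (Mz - {{c, w}})"
      using perfect_matching_remove[OF Mz w(1)] .
    obtain J where J: "perfect_matching D (insert q (insert c X)) J"
      using ear_full_perfect_matching[OF ear(1,2)] by blast
    have "\<alpha> {z, p} + sum \<alpha> (Mz - {{c, w}}) + sum \<alpha> J = \<beta>"
      by (rule zp[of w, OF _ M' J]) (use zc(1,2) disj q(1) w(3,4) \<open>z \<noteq> c\<close> in auto)
    moreover have "sum \<alpha> Mz = \<alpha> {c, w} + sum \<alpha> (Mz - {{c, w}})"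
      using w(1) by (simp add: sum.remove)
    moreover have "sum \<alpha> J = (real (card X div 2) + 1) * r"
    proof -
      have "card J = card X div 2 + 1"
        using perfect_matching_card[OF J q(3)] q ear(2) cardX by auto
      moreover have "J \<subseteq> D" using J by (auto simp: perfect_matching_def matching_def)
      ultimately show ?thesis using r by (simp add: subset_iff)
    qed
    ultimately have "r = s"
      using near[OF Mz] zc 2 sumN t s[OF w(2)] by (simp add: algebra_simps)
    then show ?thesis
      using r s t 2 sumN cardSX by (intro exI[of _ s]) (auto simp: m_def algebra_simps)
  qed
qed

text \<open>By \<open>ear_degree_equation\<close> only the common weight of the two edges at
  \<open>p\<close> is open. A matching that misses \<open>p\<close> consists of
  \<open>card (S \<union> X) div 2 + 1\<close> edges of weight \<open>s\<close>, and comparison with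
  \<open>\<beta>\<close> gives \<open>s\<close> at \<open>p\<close> too.\<close>

lemma rigid_ear:
  fixes E :: "'v::finite set set"
  assumes fc: "factor_critical E S" and rigid: "rigid E S" and card2: "\<forall>e\<in>E. card e = 2"
    and ES: "\<Union>E \<subseteq> S"
    and ear: "ear q c X D" "q \<noteq> c" "p \<notin> insert q (insert c X)" "z \<notin> insert p (insert q X)"
    and zc: "z \<in> S" "c \<in> S" "insert p (insert q X) \<inter> S = {}" "z \<noteq> c \<or> S = {z}"
  shows "rigid (E \<union> insert {z, p} (insert {p, q} D)) (S \<union> insert p (insert q X))"
  unfolding rigid_def
proof (intro allI impI)
  let ?E = "E \<union> insert {z, p} (insert {p, q} D)" and ?S = "S \<union> insert p (insert q X)"
  fix \<alpha> :: "'v set \<Rightarrow> real" and \<beta>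
  assume eq: "\<forall>v\<in>?S. \<forall>M. perfect_matching ?E (?S - {v}) M \<longrightarrow> sum \<alpha> M = \<beta>"
  then obtain s where s: "\<And>g. g \<in> E \<union> D \<Longrightarrow> \<alpha> g = s" "\<alpha> {z, p} = \<alpha> {p, q}"
      "\<beta> = \<alpha> {p, q} + real (card (S \<union> X) div 2) * s"
    using ear_degree_equation[OF fc rigid card2 ES ear zc, of \<alpha> \<beta>] by blast
  have q: "q \<notin> X" "c \<notin> X" "\<forall>e\<in>D. card e = 2"
    using ear_vertices[OF ear(1)] by auto
  obtain J where J: "perfect_matching D (insert q (insert c X)) J"
    using ear_full_perfect_matching[OF ear(1,2)] by blast
  obtain Mc where Mc: "perfect_matching E (S - {c}) Mc"
    using fc zc by (auto simp: factor_critical_def)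
  have monoE: "perfect_matching E Y K \<Longrightarrow> perfect_matching (E \<union> D) Y K"
   and monoD: "perfect_matching D Y K \<Longrightarrow> perfect_matching (E \<union> D) Y K" for Y K
    by (auto elim: perfect_matching_mono)
  have "(S - {c}) \<union> insert q (insert c X) = ?S - {p}"
    using zc ear by auto
  then have M: "perfect_matching (E \<union> D) (?S - {p}) (Mc \<union> J)"
    using perfect_matching_Un[OF monoE[OF Mc] monoD[OF J]] zc by auto
  then have "perfect_matching ?E (?S - {p}) (Mc \<union> J)"
    by (rule perfect_matching_mono) auto
  then have "sum \<alpha> (Mc \<union> J) = \<beta>" using eq by auto
  moreover have "sum \<alpha> (Mc \<union> J) = real (card (Mc \<union> J)) * s"
  proof -
    have "sum \<alpha> (Mc \<union> J) = sum (\<lambda>_. s) (Mc \<union> J)"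
      using M s(1) by (intro sum.cong) (auto simp: perfect_matching_def matching_def)
    then show ?thesis by simp
  qed
  moreover have "card (Mc \<union> J) = card (S \<union> X) div 2 + 1"
  proof -
    have "2 * card (Mc \<union> J) = card (?S - {p})"
      using perfect_matching_card[OF M] card2 q(3) by (metis UnE)
    moreover have "?S - {p} = insert q (S \<union> X)"
      using zc ear by auto
    moreover have "q \<notin> S \<union> X" using zc q by auto
    ultimately have "2 * card (Mc \<union> J) = card (S \<union> X) + 1" by simp
    then show ?thesis by presburger
  qed
  ultimately have "\<alpha> {p, q} = s"
    using s(3) by (simp add: algebra_simps)
  with s show "\<exists>s. \<forall>g\<in>?E. \<alpha> g = s" by auto
qed

section \<open>The last ear of a factor-critical graph\<close>

lemma exists_max_card:
  fixes A :: "'a::finite set"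
  assumes "P A"
  shows "\<exists>B. P B \<and> (\<forall>C. P C \<longrightarrow> card C \<le> card B)"
proof (rule ex_has_greatest_nat[of P A card "Suc (card (UNIV :: 'a set))"])
  show "P A" by (fact assms)
  show "\<forall>C. P C \<longrightarrow> card C < Suc (card (UNIV :: 'a set))"
    by (simp add: card_mono less_Suc_eq_le)
qed

lemma card_2_eqI: "card e = 2 \<Longrightarrow> a \<in> e \<Longrightarrow> b \<in> e \<Longrightarrow> a \<noteq> b \<Longrightarrow> e = {a, b}"
  by (auto simp: card_2_iff)

text \<open>The matching of \<open>S - S'\<close> is what makes alternating paths return to the
  core. The vertex set is kept apart from the edges because the initial core is a single vertex
  without edges.\<close>

definition ear_core :: "'v set set \<Rightarrow> 'v set \<Rightarrow> 'v set set \<Rightarrow> 'v set \<Rightarrow> bool" where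
  "ear_core E S E' S' \<longleftrightarrow> E' \<subseteq> E \<and> S' \<subseteq> S \<and> S' \<noteq> {} \<and> \<Union>E' \<subseteq> S' \<and>
     factor_critical E' S' \<and> rigid E' S' \<and> (\<exists>N. perfect_matching E (S - S') N)"

text \<open>
  To avoid ending up with a closed ear at \<open>a\<close>, one first grows a maximal factor-critical set \<open>A\<close>
  that meets the core only in \<open>a\<close>; since \<open>a\<close> is not a cut vertex, \<open>A - {a}\<close> has an edge
  leaving \<open>A\<close>.
\<close>

lemma ear_core_extension:
  fixes E :: "'v::finite set set"
  assumes core: "ear_core E S E' S'" and fc: "factor_critical E S" and rigid: "rigid E S"
    and card2: "\<forall>e\<in>E. card e = 2" and ES: "\<Union>E = S"
    and proper: "E' \<noteq> E" and induced: "\<And>e. e \<in> E \<Longrightarrow> e \<subseteq> S' \<Longrightarrow> e \<in> E'"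
  shows "\<exists>a c X D N. ear a c X D \<and> a \<in> S' \<and> c \<in> S' \<and> (a \<noteq> c \<or> S' = {a}) \<and> D \<subseteq> E \<and>
    X \<noteq> {} \<and> X \<subseteq> S - S' \<and> perfect_matching E (S - S' - X) N"
proof -
  have core': "E' \<subseteq> E" "S' \<subseteq> S" "S' \<noteq> {}" "\<Union>E' \<subseteq> S'"
    using core by (auto simp: ear_core_def)
  obtain N where N: "perfect_matching E (S - S') N"
    using core by (auto simp: ear_core_def)
  have "S' \<noteq> S"
    using proper induced ES core'(1) by blast
  from factor_critical_connected[OF fc card2 core'(2,3) this]
  obtain e where "e \<in> E" "e \<inter> S' \<noteq> {}" "e \<inter> (S - S') \<noteq> {}" by blast
  then obtain a b where e: "e \<in> E" "a \<in> e" "a \<in> S'" "b \<in> e" "b \<in> S - S'"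
    by blast
  then have "e = {a, b}"
    using card2 by (intro card_2_eqI) auto
  with e have ab: "{a, b} \<in> E" "a \<in> S'" "b \<in> S - S'" by auto
  have near: "\<exists>M. perfect_matching E (S - {v}) M" if "v \<in> S" for v
    using fc that by (auto simp: factor_critical_def)
  show ?thesis
  \<comment> \<open>From a one-vertex core every ear is closed, which is allowed there; in the other
    case an endpoint different from \<open>a\<close> has to be enforced.\<close>
  proof (cases "S' = {a}")
    case True
    obtain M where M: "perfect_matching E (S - {b}) M" using near ab by blast
    have "S' \<union> (S - S') - {b} = S - {b}" using core' by auto
    with M have "perfect_matching E (S' \<union> (S - S') - {b}) M" by simp
    from alternating_ear[OF N this _ _ ab(1) _ card2] ab
    obtain c X D N' where "c \<in> S'" "X \<subseteq> S - S'" "b \<in> X" "D \<subseteq> E" "ear a c X D"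
      "perfect_matching E (S - S' - X) N'"
      by auto
    then show ?thesis using True by blast
  next
    case False
    define PA where "PA A \<longleftrightarrow> A \<subseteq> S \<and> A \<inter> S' = {a} \<and> factor_critical E A \<and>
      (\<exists>N. perfect_matching E (S - (S' \<union> A)) N)" for A
    have "PA {a}"
    proof -
      have "factor_critical E {a}"
        by (simp add: factor_critical_def) (use perfect_matching_empty in blast)
      moreover have "S - (S' \<union> {a}) = S - S'" using ab by auto
      ultimately show ?thesis using ab core' N by (auto simp: PA_def)
    qed
    then obtain A where A: "PA A" and max: "\<And>B. PA B \<Longrightarrow> card B \<le> card A"
      using exists_max_card[of PA] by blast
    have AS: "A \<subseteq> S" "A \<inter> S' = {a}" "a \<in> A" "factor_critical E A"
      using A by (auto simp: PA_def)
    obtain NA where NA: "perfect_matching E (S - (S' \<union> A)) NA"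
      using A by (auto simp: PA_def)
    obtain d where d: "d \<in> S'" "d \<noteq> a" using False ab by blast
    \<comment> \<open>Edges from \<open>a\<close> into the core lead nowhere and are excluded by the
      last clause. The vertex \<open>d\<close> guarantees that \<open>A - {a}\<close> is not
      everything outside \<open>a\<close>.\<close>
    have "\<exists>z y. {z, y} \<in> E \<and> z \<in> A \<and> y \<notin> A \<and> (z \<noteq> a \<or> y \<notin> S')"
    proof (cases "A = {a}")
      case True
      then show ?thesis using ab by blast
    next
      case False
      have "A - {a} \<noteq> S - {a}" using d AS core' by blast
      then obtain e where "e \<in> E" "e \<inter> (A - {a}) \<noteq> {}" "e \<inter> (S - {a} - (A - {a})) \<noteq> {}"
        using rigid_connected_minus[OF fc rigid card2, of a "A - {a}"] ES AS False by blast
      then obtain z y where zy: "e \<in> E" "z \<in> e" "z \<in> A" "z \<noteq> a" "y \<in> e" "y \<notin> A" by blast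
      then have "e = {z, y}"
        using card2 by (intro card_2_eqI) auto
      with zy show ?thesis by blast
    qed
    then obtain z y where zy: "{z, y} \<in> E" "z \<in> A" "y \<notin> A" "z \<noteq> a \<or> y \<notin> S'" by blast
    then have yS: "y \<in> S" using ES by blast
    obtain Mz where Mz: "perfect_matching E (A - {z}) Mz"
      using AS zy by (auto simp: factor_critical_def)
    \<comment> \<open>Either the ear found from \<open>z\<close> already starts at \<open>a\<close>,
      or \<open>z\<close> and a core vertex \<open>c\<close> other than \<open>a\<close> can be
      matched together with all vertices outside \<open>S' \<union> A\<close>.\<close>
    have "(\<exists>c\<in>S' - {a}. \<exists>K. perfect_matching E (insert z (insert c (S - (S' \<union> A)))) K) \<and> z \<noteq> a \<or> ?thesis"
    proof (cases "y \<in> S'")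
      case True
      have "perfect_matching E (insert z (insert y (S - (S' \<union> A)))) (insert {z, y} NA)"
        using perfect_matching_insert[OF NA zy(1)] True zy by auto
      moreover have "y \<in> S' - {a}" using True zy AS by auto
      ultimately show ?thesis using True zy by blast
    next
      case False
      obtain M where M: "perfect_matching E (S - {y}) M" using near yS by blast
      have "(S' \<union> A) \<union> (S - (S' \<union> A)) - {y} = S - {y}" using core' AS by auto
      with M have "perfect_matching E ((S' \<union> A) \<union> (S - (S' \<union> A)) - {y}) M" by simp
      from alternating_ear[OF NA this _ _ zy(1) _ card2] yS zy False
      obtain c X D N' where X: "c \<in> S' \<union> A" "X \<subseteq> S - (S' \<union> A)" "y \<in> X" "D \<subseteq> E" "ear z c X D"
        "perfect_matching E (S - (S' \<union> A) - X) N'"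
        by auto
      \<comment> \<open>An ear that returns to \<open>A\<close> would give a larger set with the
        property \<open>PA\<close>.\<close>
      have "c \<notin> A"
      proof
        assume "c \<in> A"
        have "X \<inter> A = {}" using X by auto
        from factor_critical_ear[OF AS(4) X(5) zy(2) \<open>c \<in> A\<close> this]
        have "factor_critical E (A \<union> X)"
          using X(4) by (simp add: Un_absorb2)
        moreover have "S - (S' \<union> (A \<union> X)) = S - (S' \<union> A) - X" by auto
        moreover have "(A \<union> X) \<inter> S' = {a}" using X(2) AS(2) by auto
        ultimately have "PA (A \<union> X)"
          using X AS by (auto simp: PA_def)
        from max[OF this] have "card (A \<union> X) \<le> card A" .
        moreover have "card A < card (A \<union> X)"
          using X(2,3) by (intro psubset_card_mono) auto
        ultimately show False by simp
      qed
      then have c: "c \<in> S' - {a}" "z \<noteq> c" using X(1) AS zy by auto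
      show ?thesis
      proof (cases "z = a")
        case True
        obtain NX where "perfect_matching E (A - {a}) NX"
          using AS by (auto simp: factor_critical_def)
        from perfect_matching_Un[OF this X(6)]
        have "perfect_matching E ((A - {a}) \<union> (S - (S' \<union> A) - X)) (NX \<union> N')" by auto
        moreover have "(A - {a}) \<union> (S - (S' \<union> A) - X) = S - S' - X"
          using AS X(2) by auto
        ultimately have "perfect_matching E (S - S' - X) (NX \<union> N')" by simp
        moreover have "X \<subseteq> S - S'" using X(2) by auto
        ultimately show ?thesis using X c True ab by blast
      next
        case zna: False
        obtain K where "perfect_matching D (insert z (insert c X)) K"
          using ear_full_perfect_matching[OF X(5) c(2)] by blast
        then have K: "perfect_matching E (insert z (insert c X)) K"
          using X(4) by (rule perfect_matching_mono)
        have "perfect_matching E (insert z (insert c X) \<union> (S - (S' \<union> A) - X)) (K \<union> N')"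
          using c zy by (intro perfect_matching_Un[OF K X(6)]) auto
        moreover have "insert z (insert c X) \<union> (S - (S' \<union> A) - X) = insert z (insert c (S - (S' \<union> A)))"
          using X(2) by auto
        ultimately have "perfect_matching E (insert z (insert c (S - (S' \<union> A)))) (K \<union> N')"
          by simp
        with c zna show ?thesis by blast
      qed
    qed
    then show ?thesis
    proof
      assume "(\<exists>c\<in>S' - {a}. \<exists>K. perfect_matching E (insert z (insert c (S - (S' \<union> A)))) K) \<and> z \<noteq> a"
      then obtain c K where c: "c \<in> S' - {a}" "z \<noteq> a"
        and K: "perfect_matching E (insert z (insert c (S - (S' \<union> A)))) K" by blast
      have cA: "c \<notin> A" "z \<notin> S'" using c AS zy by auto
      obtain y0 where y0: "{a, y0} \<in> Mz" "{a, y0} \<in> E" "y0 \<noteq> a" "y0 \<in> A - {z}"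
        using perfect_matching_partner[OF Mz card2, of a] AS c by auto
      then have y0': "y0 \<in> S - S'" using AS by auto
      \<comment> \<open>Removing the edge from \<open>a\<close> to its partner \<open>y0\<close>
        leaves a matching of all of \<open>S - S'\<close> but \<open>y0\<close> that uses no core
        vertex except \<open>c\<close>. With \<open>C = {c}\<close>, the alternating path from
        \<open>a\<close> through \<open>y0\<close> is forced to end at \<open>c\<close>.\<close>
      have "perfect_matching E ((A - {z} - {a, y0}) \<union> insert z (insert c (S - (S' \<union> A)))) ((Mz - {{a, y0}}) \<union> K)"
        using cA by (intro perfect_matching_Un[OF perfect_matching_remove[OF Mz y0(1)] K]) auto
      moreover have "(A - {z} - {a, y0}) \<union> insert z (insert c (S - (S' \<union> A))) = {c} \<union> (S - S') - {y0}"
        using cA y0 AS zy c by auto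
      ultimately have "perfect_matching E ({c} \<union> (S - S') - {y0}) ((Mz - {{a, y0}}) \<union> K)"
        by simp
      from alternating_ear[OF N this _ y0' y0(2) _ card2] c ab
      obtain X D N' where "X \<subseteq> S - S'" "y0 \<in> X" "D \<subseteq> E" "ear a c X D"
        "perfect_matching E (S - S' - X) N'"
        by auto
      then show ?thesis using c ab by blast
    qed
  qed
qed

lemma ear_core_exists:
  assumes "factor_critical E S" "S \<noteq> {}"
  shows "\<exists>S'. ear_core E S {} S'"
proof -
  obtain a where a: "a \<in> S" using assms by blast
  then have "\<exists>N. perfect_matching E (S - {a}) N"
    using assms by (auto simp: factor_critical_def)
  moreover have "factor_critical {} {a}"
    by (simp add: factor_critical_def) (use perfect_matching_empty in blast)
  ultimately have "ear_core E S {} {a}"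
    using a by (auto simp: ear_core_def rigid_def)
  then show ?thesis by blast
qed

text \<open>In a longer ear the only edge at the start leads to an inner vertex. This serves to
  recognise the triangle.\<close>

lemma ear_direct_edge:
  assumes "ear q c X D" "{q, c} \<in> D" "q \<noteq> c"
  shows "X = {}"
  using assms(1)
proof cases
  case (step q' X' D' p')
  from ear_vertices(3)[OF step(3)] have "\<Union>D' = insert q' (insert c X')" .
  with step assms(2,3) show ?thesis by (auto simp: doubleton_eq_iff)
qed simp

text \<open>
  In the second case \<open>v\<close> is the first inner vertex of the last ear. A triangle falls under the
  first case, because its vertices do not have two nonadjacent neighbours.
\<close>

theorem factor_critical_last_ear:
  fixes E :: "'v::finite set set"
  assumes fc: "factor_critical E S" and rigid: "rigid E S"
    and card2: "\<forall>e\<in>E. card e = 2" and ES: "\<Union>E = S" and ne: "E \<noteq> {}"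
  shows "(\<exists>e\<in>E. (\<exists>v\<in>S. \<exists>M. perfect_matching (E - {e}) (S - {v}) M) \<and>
      (\<forall>(\<alpha> :: 'v set \<Rightarrow> real) \<beta>.
        (\<forall>v\<in>S. \<forall>M. perfect_matching (E - {e}) (S - {v}) M \<longrightarrow> sum \<alpha> M = \<beta>) \<longrightarrow>
        (\<exists>s. \<forall>g\<in>E - {e}. \<alpha> g = s))) \<or>
    (\<exists>v a b. a \<noteq> b \<and> {v, a} \<in> E \<and> {v, b} \<in> E \<and> {a, b} \<notin> E \<and>
      (\<forall>(\<alpha> :: 'v set \<Rightarrow> real) \<beta>.
        (\<forall>u\<in>S - {v}. \<forall>M. perfect_matching E (S - {u}) M \<longrightarrow> sum \<alpha> M = \<beta>) \<longrightarrow>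
        (\<exists>s t. \<forall>g\<in>E. \<alpha> g = (if v \<in> g then t else s))))"
    (is "?edge \<or> ?ear")
proof -
  have "S \<noteq> {}" using ne ES card2 by fastforce
  define PE where "PE E' \<longleftrightarrow> E' \<noteq> E \<and> (\<exists>S'. ear_core E S E' S')" for E'
  have "PE {}" using ear_core_exists[OF fc \<open>S \<noteq> {}\<close>] ne by (auto simp: PE_def)
  then obtain E' where E': "PE E'" and max: "\<And>B. PE B \<Longrightarrow> card B \<le> card E'"
    using exists_max_card[of PE] by blast
  then obtain S' where core: "ear_core E S E' S'" and proper: "E' \<noteq> E"
    by (auto simp: PE_def)
  have core': "E' \<subseteq> E" "S' \<subseteq> S" "S' \<noteq> {}" "\<Union>E' \<subseteq> S'" "factor_critical E' S'" "rigid E' S'"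
    using core by (auto simp: ear_core_def)
  have card2': "\<forall>e\<in>E'. card e = 2" using core' card2 by auto
  have whole: "B = E" if "E' \<subset> B" "ear_core E S B T" for B T
  proof (rule ccontr)
    assume "B \<noteq> E"
    with that have "PE B" by (auto simp: PE_def)
    from max[OF this] psubset_card_mono[OF _ that(1)] show False by auto
  qed
  show ?thesis
  proof (cases "\<exists>e\<in>E - E'. e \<subseteq> S'")
    case True
    then obtain e where e: "e \<in> E" "e \<notin> E'" "e \<subseteq> S'" by blast
    have "\<forall>g\<in>insert e E'. card g = 2" using card2 card2' e by auto
    from rigid_insert[OF core'(5,6) this e(3)] have "ear_core E S (insert e E') S'"
      using core e by (auto simp: ear_core_def intro: factor_critical_mono)
    then have eq: "insert e E' = E" by (intro whole) (use e in auto)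
    have SS: "S' = S" using eq ES core'(2,4) e(3) by auto
    have "E - {e} = E'" using eq e by auto
    with core' SS \<open>S \<noteq> {}\<close> have ?edge
      by (intro bexI[OF _ e(1)]) (auto simp: factor_critical_def rigid_def)
    then show ?thesis ..
  next
    case False
    then have "\<And>e. e \<in> E \<Longrightarrow> e \<subseteq> S' \<Longrightarrow> e \<in> E'" by blast
    from ear_core_extension[OF core fc rigid card2 ES proper this]
    obtain a c X D N where aX: "ear a c X D" "a \<in> S'" "c \<in> S'" "a \<noteq> c \<or> S' = {a}" "D \<subseteq> E"
      "X \<noteq> {}" "X \<subseteq> S - S'" "perfect_matching E (S - S' - X) N"
      by blast
    from aX(1) show ?thesis
    proof cases
      case edge
      with aX show ?thesis by simp
    next
      case (step q X' D' p)
      have disj: "insert p (insert q X') \<inter> S' = {}" using aX step by auto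
      let ?E = "E' \<union> insert {a, p} (insert {p, q} D')" and ?S = "S' \<union> insert p (insert q X')"
      note ear = step(3-6) aX(2,3) disj aX(4)
      have ES': "\<Union>?E \<subseteq> ?S"
        using core'(4) ear_vertices(3)[OF aX(1)] aX(2,3) step by auto
      have "ear_core E S ?E ?S"
        unfolding ear_core_def
      proof (intro conjI)
        show "factor_critical ?E ?S"
          using factor_critical_ear[OF core'(5) aX(1-3)] disj step by auto
        show "rigid ?E ?S"
          by (rule rigid_ear[OF core'(5,6) card2' core'(4) ear])
        show "\<exists>N. perfect_matching E (S - ?S) N"
          using aX(8) step by (metis Diff_Diff_Int Diff_eq Int_assoc compl_sup)
        show "\<Union>?E \<subseteq> ?S" by (fact ES')
      qed (use core' aX step in auto)
      moreover have "{a, p} \<notin> E'" using core'(4) disj by auto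
      ultimately have eqE: "?E = E" by (intro whole) auto
      have eqS: "?S = S"
      proof
        show "?S \<subseteq> S" using core'(2) aX(7) step by auto
        show "S \<subseteq> ?S" using ES' by (simp only: eqE ES)
      qed
      have vD': "\<Union>D' = insert q (insert c X')" "q \<notin> X'"
        using ear_vertices[OF step(3)] by auto
      have pD: "p \<notin> g" if "g \<in> E' \<union> D'" for g
        using that core'(4) disj vD' step by auto
      have eq: "\<exists>s t. \<forall>g\<in>E. \<alpha> g = (if p \<in> g then t else s)"
        if "\<forall>u\<in>S - {p}. \<forall>M. perfect_matching E (S - {u}) M \<longrightarrow> sum \<alpha> M = \<beta>"
        for \<alpha> :: "'v set \<Rightarrow> real" and \<beta>
      proof -
        have "\<exists>s. (\<forall>g\<in>E' \<union> D'. \<alpha> g = s) \<and> \<alpha> {a, p} = \<alpha> {p, q} \<and>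
            \<beta> = \<alpha> {p, q} + real (card (S' \<union> X') div 2) * s"
          by (rule ear_degree_equation[OF core'(5,6) card2' core'(4) ear])
            (use that eqE eqS in auto)
        then obtain s where s: "\<And>g. g \<in> E' \<union> D' \<Longrightarrow> \<alpha> g = s" "\<alpha> {a, p} = \<alpha> {p, q}"
          by blast
        have "\<alpha> g = (if p \<in> g then \<alpha> {p, q} else s)" if "g \<in> E" for g
          using that s pD[of g] eqE by (cases "g \<in> E' \<union> D'") auto
        then show ?thesis by blast
      qed
      show ?thesis
      \<comment> \<open>The neighbours of \<open>p\<close> are \<open>a\<close> and
        \<open>q\<close>. If they are adjacent, \<open>{a, q}\<close> must be the whole remaining
        ear, which therefore closes up at a one-vertex core, and the graph is a triangle.\<close>
      proof (cases "{a, q} \<in> E")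
        case True
        have "{a, q} \<in> D'"
          using True eqE core'(4) disj step by (auto simp: doubleton_eq_iff)
        then have ac: "a = c" using vD' step by auto
        with \<open>{a, q} \<in> D'\<close> have "X' = {}"
          using ear_direct_edge[OF step(3)] step by (simp add: insert_commute)
        have S': "S' = {a}" using ac aX by auto
        have "E' = {}"
        proof (rule ccontr)
          assume "E' \<noteq> {}"
          then obtain e where e: "e \<in> E'" by auto
          then have "e \<subseteq> {a}" using core'(4) S' by auto
          then have "card e \<le> 1" using card_mono[of "{a}" e] by simp
          with e card2' show False by auto
        qed
        have "D' = {{a, q}}"
          using step(3) ac \<open>X' = {}\<close> by cases (auto simp: insert_commute)
        with \<open>E' = {}\<close> eqE have E: "E = {{a, p}, {p, q}, {a, q}}" by auto
        have S: "S = {a, p, q}" using eqS S' \<open>X' = {}\<close> by auto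
        have diff: "a \<noteq> p" "a \<noteq> q" "p \<noteq> q" using step by auto
        then have E1: "E - {{a, q}} = {{a, p}, {p, q}}" using E by (auto simp: doubleton_eq_iff)
        have M1: "perfect_matching (E - {{a, q}}) (S - {q}) {{a, p}}"
          using E1 S diff by (auto simp: perfect_matching_def matching_def)
        have M2: "perfect_matching (E - {{a, q}}) (S - {a}) {{p, q}}"
          using E1 S diff by (auto simp: perfect_matching_def matching_def)
        have "\<exists>s. \<forall>g\<in>E - {{a, q}}. \<alpha> g = s"
          if "\<forall>v\<in>S. \<forall>M. perfect_matching (E - {{a, q}}) (S - {v}) M \<longrightarrow> sum \<alpha> M = \<beta>"
          for \<alpha> :: "'v set \<Rightarrow> real" and \<beta>
        proof -
          have "\<alpha> {a, p} = \<beta>" "\<alpha> {p, q} = \<beta>"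
            using that M1 M2 S by force+
          then show ?thesis using E1 by auto
        qed
        then have ?edge using M1 True S by blast
        then show ?thesis ..
      next
        case False
        moreover have "{p, a} \<in> E" "{p, q} \<in> E" using eqE by (auto simp: insert_commute)
        moreover have "a \<noteq> q" using step by auto
        ultimately have ?ear using eq by blast
        then show ?thesis ..
      qed
    qed
  qed
qed

section \<open>Gallai's lemma\<close>

lemma matching_perfect_matching: "matching E M \<Longrightarrow> perfect_matching E (\<Union>M) M"
  by (simp add: perfect_matching_def)

lemma perfect_matching_matching: "perfect_matching E X M \<Longrightarrow> matching E M"
  by (simp add: perfect_matching_def)

text \<open>
  Exchange along the component of \<open>v\<close> in the union of the two matchings; its other end is \<open>w\<close>.
\<close>

lemma matching_exchange:
  fixes f :: "'v::finite set \<Rightarrow> real"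
  assumes "matching E M" "matching E N" "\<forall>e\<in>E. card e = 2" "v \<notin> \<Union>N"
  shows "\<exists>M' N' w. matching E M' \<and> matching E N' \<and> sum f M' + sum f N' = sum f M + sum f N \<and>
    v \<notin> \<Union>M' \<and> \<Union>M' \<subseteq> insert w (\<Union>M) \<and> \<Union>M' \<union> \<Union>N' \<subseteq> \<Union>M \<union> \<Union>N"
  using assms
proof (induction "card M" arbitrary: M N v rule: less_induct)
  case less
  note card2 = less.prems(3)
  note pM = matching_perfect_matching[OF less.prems(1)] and pN = matching_perfect_matching[OF less.prems(2)]
  show ?case
  proof (cases "v \<in> \<Union>M")
    case False
    with less.prems show ?thesis by blast
  next
    case True
    obtain v1 where v1: "{v, v1} \<in> M" "{v, v1} \<in> E" "v1 \<noteq> v" and v1M: "v1 \<in> \<Union>M"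
      by (rule perfect_matching_partner[OF pM card2 True])
    define M0 where "M0 = M - {{v, v1}}"
    have M0: "perfect_matching E (\<Union>M - {v, v1}) M0"
      unfolding M0_def by (rule perfect_matching_remove[OF pM v1(1)])
    have sM: "sum f M = f {v, v1} + sum f M0"
      unfolding M0_def using v1(1) by (simp add: sum.remove)
    show ?thesis
    proof (cases "v1 \<in> \<Union>N")
      case False
      have N': "perfect_matching E (insert v (insert v1 (\<Union>N))) (insert {v, v1} N)"
        by (rule perfect_matching_insert[OF pN v1(2) less.prems(4) False])
      have "sum f (insert {v, v1} N) = f {v, v1} + sum f N"
        by (rule perfect_matching_sum_insert[OF pN less.prems(4)])
      then have "sum f M0 + sum f (insert {v, v1} N) = sum f M + sum f N"
        using sM by simp
      moreover have M0': "\<Union>M0 = \<Union>M - {v, v1}"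
        using M0 by (simp add: perfect_matching_def)
      then have "v \<notin> \<Union>M0" "\<Union>M0 \<subseteq> insert v (\<Union>M)" by auto
      moreover have "\<Union>M0 \<union> \<Union>(insert {v, v1} N) \<subseteq> \<Union>M \<union> \<Union>N"
        using True v1M M0' by auto
      ultimately show ?thesis
        using perfect_matching_matching[OF M0] perfect_matching_matching[OF N'] by blast
    next
      case v1N: True
      obtain v2 where v2: "{v1, v2} \<in> N" "{v1, v2} \<in> E" "v2 \<noteq> v1" "v2 \<in> \<Union>N"
        by (rule perfect_matching_partner[OF pN card2 v1N])
      have v2v: "v2 \<noteq> v" using v2(4) less.prems(4) by metis
      define N0 where "N0 = N - {{v1, v2}}"
      have N0: "perfect_matching E (\<Union>N - {v1, v2}) N0"
        unfolding N0_def by (rule perfect_matching_remove[OF pN v2(1)])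
      have sN: "sum f N = f {v1, v2} + sum f N0"
        unfolding N0_def using v2(1) by (simp add: sum.remove)
      \<comment> \<open>The path continues at \<open>v2\<close>. If \<open>M\<close> does not cover
        \<open>v2\<close>, it ends there and \<open>w = v2\<close>; otherwise \<open>w\<close> comes
        from the induction hypothesis. Afterwards \<open>{v, v1}\<close> and \<open>{v1, v2}\<close>
        change sides.\<close>
      have "\<exists>M0' N0' w. matching E M0' \<and> matching E N0' \<and> sum f M0' + sum f N0' = sum f M0 + sum f N0 \<and>
        v2 \<notin> \<Union>M0' \<and> insert v1 (insert v2 (\<Union>M0')) \<subseteq> insert w (\<Union>M) \<and>
        \<Union>M0' \<union> \<Union>N0' \<subseteq> \<Union>M0 \<union> \<Union>N0"
      proof (cases "v2 \<in> \<Union>M")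
        case False
        moreover have "\<Union>M0 \<subseteq> \<Union>M" unfolding M0_def by auto
        ultimately have "v2 \<notin> \<Union>M0" "insert v1 (insert v2 (\<Union>M0)) \<subseteq> insert v2 (\<Union>M)"
          using v1M by auto
        then show ?thesis
          using perfect_matching_matching[OF M0] perfect_matching_matching[OF N0] by blast
      next
        case True
        have "card M0 < card M"
          unfolding M0_def using v1(1) by (intro psubset_card_mono) auto
        moreover have "v2 \<notin> \<Union>N0" using N0 by (auto simp: perfect_matching_def)
        ultimately obtain M0' N0' w where "matching E M0'" "matching E N0'"
          "sum f M0' + sum f N0' = sum f M0 + sum f N0" "v2 \<notin> \<Union>M0'"
          "\<Union>M0' \<subseteq> insert w (\<Union>M0)" "\<Union>M0' \<union> \<Union>N0' \<subseteq> \<Union>M0 \<union> \<Union>N0"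
          using less.hyps[of M0 N0 v2] M0 N0 card2 perfect_matching_matching by metis
        moreover have "\<Union>M0 \<subseteq> \<Union>M" unfolding M0_def by auto
        ultimately show ?thesis using True v1M by blast
      qed
      then obtain M0' N0' w where IH: "matching E M0'" "matching E N0'"
        "sum f M0' + sum f N0' = sum f M0 + sum f N0" "v2 \<notin> \<Union>M0'"
        "insert v1 (insert v2 (\<Union>M0')) \<subseteq> insert w (\<Union>M)" "\<Union>M0' \<union> \<Union>N0' \<subseteq> \<Union>M0 \<union> \<Union>N0"
        by (elim exE conjE) (rule that)
      have "\<Union>M0 = \<Union>M - {v, v1}" "\<Union>N0 = \<Union>N - {v1, v2}"
        using M0 N0 by (auto simp: perfect_matching_def)
      then have "\<Union>M0 \<union> \<Union>N0 \<subseteq> (\<Union>M \<union> \<Union>N) - {v, v1}"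
        using less.prems(4) by (simp only:) blast
      with IH(6) have sub: "\<Union>M0' \<union> \<Union>N0' \<subseteq> (\<Union>M \<union> \<Union>N) - {v, v1}"
        by (rule order_trans)
      have M': "perfect_matching E (insert v1 (insert v2 (\<Union>M0'))) (insert {v1, v2} M0')"
        using sub IH(4) by (intro perfect_matching_insert[OF matching_perfect_matching[OF IH(1)] v2(2)]) auto
      have N': "perfect_matching E (insert v (insert v1 (\<Union>N0'))) (insert {v, v1} N0')"
        using sub by (intro perfect_matching_insert[OF matching_perfect_matching[OF IH(2)] v1(2)]) auto
      have "sum f (insert {v1, v2} M0') = f {v1, v2} + sum f M0'"
        using perfect_matching_sum_insert[OF matching_perfect_matching[OF IH(1)], of v1 f v2] sub by auto
      moreover have "sum f (insert {v, v1} N0') = f {v, v1} + sum f N0'"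
        using perfect_matching_sum_insert[OF matching_perfect_matching[OF IH(2)], of v f v1] sub by auto
      ultimately have "sum f (insert {v1, v2} M0') + sum f (insert {v, v1} N0') = sum f M + sum f N"
        using IH(3) sM sN by simp
      moreover have "v \<notin> \<Union>(insert {v1, v2} M0')"
        using sub v1 v2v by auto
      moreover have "\<Union>(insert {v1, v2} M0') \<subseteq> insert w (\<Union>M)"
        using IH(5) by auto
      moreover have "\<Union>(insert {v1, v2} M0') \<union> \<Union>(insert {v, v1} N0') \<subseteq> \<Union>M \<union> \<Union>N"
        using sub True v1M v2(4) by auto
      ultimately show ?thesis
        using perfect_matching_matching[OF M'] perfect_matching_matching[OF N'] by blast
    qed
  qed
qed

text \<open>A weighted form of Gallai's lemma. Let \<open>R\<close> relate vertices that no optimal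
  matching misses together. Positive weights make adjacent vertices related, exchange makes
  \<open>R\<close> transitive, and connectedness makes it total, so at most one vertex is missed. By
  parity one is missed, since some optimal matching misses exactly one.\<close>

lemma optimal_matching_near_perfect:
  fixes f :: "'v::finite set \<Rightarrow> real"
  assumes card2: "\<forall>e\<in>E. card e = 2" and pos: "\<And>e. e \<in> E \<Longrightarrow> f e > 0"
    and bound: "\<And>M. matching E M \<Longrightarrow> sum f M \<le> b"
    and S: "\<Union>E = S"
    and conn: "\<And>X. X \<subseteq> S \<Longrightarrow> X \<noteq> {} \<Longrightarrow> X \<noteq> S \<Longrightarrow> \<exists>e\<in>E. e \<inter> X \<noteq> {} \<and> e \<inter> (S - X) \<noteq> {}"
    and missed: "\<And>v. v \<in> S \<Longrightarrow> \<exists>M. matching E M \<and> sum f M = b \<and> v \<notin> \<Union>M"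
    and M: "matching E M" "sum f M = b" and ne: "E \<noteq> {}"
  shows "\<exists>v\<in>S. \<Union>M = S - {v}"
proof -
  define R where "R u v \<longleftrightarrow> u = v \<or> \<not> (\<exists>M. matching E M \<and> sum f M = b \<and> u \<notin> \<Union>M \<and> v \<notin> \<Union>M)" for u v
  have adj: "R u v" if "{u, v} \<in> E" for u v
  proof (rule ccontr)
    assume "\<not> R u v"
    then obtain M where M: "matching E M" "sum f M = b" "u \<notin> \<Union>M" "v \<notin> \<Union>M"
      by (auto simp: R_def)
    note pM = matching_perfect_matching[OF M(1)]
    have "sum f (insert {u, v} M) = f {u, v} + b"
      using perfect_matching_sum_insert[OF pM M(3), of f v] M(2) by simp
    moreover have "sum f (insert {u, v} M) \<le> b"
      using bound perfect_matching_matching[OF perfect_matching_insert[OF pM that M(3,4)]] by blast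
    ultimately show False using pos[OF that] by simp
  qed
  have trans: "R u w" if uvw: "R u v" "R v w" "v \<in> S" for u v w
  proof (rule ccontr)
    assume n: "\<not> R u w"
    then obtain M where M: "matching E M" "sum f M = b" "u \<notin> \<Union>M" "w \<notin> \<Union>M"
      by (auto simp: R_def)
    obtain N where N: "matching E N" "sum f N = b" "v \<notin> \<Union>N"
      using missed[OF uvw(3)] by blast
    have neq: "u \<noteq> w" "u \<noteq> v" "v \<noteq> w" using n uvw by (auto simp: R_def)
    obtain M' N' x where M': "matching E M'" "matching E N'" "sum f M' + sum f N' = b + b"
      "v \<notin> \<Union>M'" "\<Union>M' \<subseteq> insert x (\<Union>M)"
      using matching_exchange[OF M(1) N(1) card2 N(3), of f] M(2) N(2) by metis
    \<comment> \<open>Both weights are at most \<open>b\<close> and add up to \<open>b + b\<close>.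
      Only one vertex \<open>x\<close> is gained, so the optimal \<open>M'\<close> misses
      \<open>v\<close> and still \<open>u\<close> or \<open>w\<close>.\<close>
    have sM': "sum f M' = b" using bound[OF M'(1)] bound[OF M'(2)] M'(3) by linarith
    have "u \<notin> \<Union>M' \<or> w \<notin> \<Union>M'" using M'(5) M(3,4) neq(1) by blast
    then show False using uvw(1,2) neq(2,3) M'(1,4) sM' unfolding R_def by metis
  qed
  have all: "R u v" if "u \<in> S" "v \<in> S" for u v
  proof (rule ccontr)
    assume "\<not> R u v"
    let ?X = "{x \<in> S. R u x}"
    have "u \<in> ?X" using that by (auto simp: R_def)
    moreover have "?X \<noteq> S" using \<open>\<not> R u v\<close> that by blast
    ultimately obtain e where e: "e \<in> E" "e \<inter> ?X \<noteq> {}" "e \<inter> (S - ?X) \<noteq> {}"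
      using conn[of ?X] by blast
    then obtain x y where xy: "x \<in> e" "x \<in> S" "R u x" "y \<in> e" "y \<in> S" "\<not> R u y" by blast
    then have "e = {x, y}" using card2 e by (intro card_2_eqI) auto
    then have "R x y" using adj e by blast
    with trans xy show False by blast
  qed
  have one: "\<Union>L = S - {v}" if L: "matching E L" "sum f L = b" "v \<in> S" "v \<notin> \<Union>L" for L v
  proof
    show "\<Union>L \<subseteq> S - {v}" using L S by (auto simp: matching_def)
    show "S - {v} \<subseteq> \<Union>L"
    proof
      fix x assume x: "x \<in> S - {v}"
      then have "R x v" using all L(3) by blast
      with x L show "x \<in> \<Union>L" unfolding R_def by (metis Diff_iff singletonI)
    qed
  qed
  have "\<Union>M \<noteq> S"
  proof
    assume eq: "\<Union>M = S"
    obtain e where e: "e \<in> E" using ne by auto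
    then have "e \<noteq> {}" using card2 by auto
    then obtain v where "v \<in> e" by auto
    with e S have v: "v \<in> S" by auto
    then obtain L where L: "matching E L" "sum f L = b" "v \<notin> \<Union>L" using missed by blast
    have "card (S - {v}) = 2 * card L"
      using perfect_matching_card[OF matching_perfect_matching[OF L(1)] card2] one[OF L(1,2) v L(3)] by simp
    moreover have "card S = 2 * card M"
      using perfect_matching_card[OF matching_perfect_matching[OF M(1)] card2] eq by simp
    moreover have "card S = Suc (card (S - {v}))" using v by (metis card_Suc_Diff1 finite)
    ultimately show False by presburger
  qed
  moreover have "\<Union>M \<subseteq> S" using M S by (auto simp: matching_def)
  ultimately obtain v where v: "v \<in> S" "v \<notin> \<Union>M" by blast
  show ?thesis using one[OF M v] v(1) by metis
qed

section \<open>Facets and integer points\<close>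

lemma subspace_coord_space: "subspace (coord_space S)"
  by (auto simp: subspace_def coord_space_def)

lemma dim_coord_space: "dim (coord_space S) = card S"
  using dim_substandard_cart[of S, where 'a = real] by (simp add: coord_space_def dim_vec_eq)

lemma incidence_vector_in_coord_space: "M \<subseteq> S \<Longrightarrow> incidence_vector M \<in> coord_space S"
  by (auto simp: coord_space_def incidence_vector_def)

lemma inner_incidence_vector:
  fixes x :: "real ^ 'n::finite"
  shows "x \<bullet> incidence_vector M = (\<Sum>i\<in>M. x $ i)"
proof -
  have "x \<bullet> incidence_vector M = (\<Sum>i\<in>UNIV. if i \<in> M then x $ i else 0)"
    by (auto simp: inner_vec_def incidence_vector_def intro!: sum.cong)
  also have "\<dots> = (\<Sum>i\<in>M. x $ i)"
    by (simp add: sum.If_cases)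
  finally show ?thesis .
qed

lemma incidence_vector_inner:
  fixes x :: "real ^ 'n::finite"
  shows "incidence_vector M \<bullet> x = (\<Sum>i\<in>M. x $ i)"
  by (simp add: inner_commute inner_incidence_vector)

lemma incidence_vector_nth: "incidence_vector M $ i = (if i \<in> M then 1 else 0)"
  by (simp add: incidence_vector_def)

lemma sum_incidence_vector:
  "(\<Sum>i\<in>M. incidence_vector A $ i) = real (card (M \<inter> A))" for M A :: "'n::finite set"
  by (simp add: incidence_vector_def sum.If_cases)

text \<open>The functionals constant on \<open>K\<close> form the orthogonal complement, within
  \<open>coord_space S\<close>, of the direction space of \<open>K\<close>.\<close>

lemma aff_dim_coord_subset:
  fixes K :: "(real ^ 'n::finite) set"
  assumes "K \<subseteq> coord_space S" "K \<noteq> {}"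
  shows "aff_dim K = int (card S) - int (dim {y \<in> coord_space S. \<exists>b. \<forall>x\<in>K. y \<bullet> x = b})"
proof -
  obtain a where a: "a \<in> K" using assms by blast
  define U where "U = span ((+) (- a) ` K)"
  have "(+) (- a) ` K \<subseteq> coord_space S"
    using assms a by (auto simp: coord_space_def subset_iff)
  then have U: "U \<subseteq> coord_space S"
    unfolding U_def by (intro span_minimal subspace_coord_space)
  have "(\<forall>x\<in>U. orthogonal x y) \<longleftrightarrow> (\<exists>b. \<forall>x\<in>K. y \<bullet> x = b)" for y
  proof
    assume o: "\<forall>x\<in>U. orthogonal x y"
    have "y \<bullet> x = y \<bullet> a" if "x \<in> K" for x
    proof -
      have "- a + x \<in> U" unfolding U_def using that by (intro span_base) auto
      with o have "(x - a) \<bullet> y = 0" by (auto simp: orthogonal_def)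
      then show ?thesis by (simp add: inner_diff_left inner_commute[of y])
    qed
    then show "\<exists>b. \<forall>x\<in>K. y \<bullet> x = b" by blast
  next
    assume "\<exists>b. \<forall>x\<in>K. y \<bullet> x = b"
    then obtain b where b: "\<And>x. x \<in> K \<Longrightarrow> y \<bullet> x = b" by blast
    show "\<forall>x\<in>U. orthogonal x y"
    proof
      fix x assume "x \<in> U"
      have "orthogonal y x"
      proof (rule orthogonal_to_span)
        show "x \<in> span ((+) (- a) ` K)" using \<open>x \<in> U\<close> by (simp add: U_def)
        show "orthogonal y z" if "z \<in> (+) (- a) ` K" for z
          using that b a by (auto simp: orthogonal_def inner_diff_right)
      qed
      then show "orthogonal x y" by (simp add: orthogonal_commute)
    qed
  qed
  then have eq: "{y \<in> coord_space S. \<forall>x\<in>U. orthogonal x y} = {y \<in> coord_space S. \<exists>b. \<forall>x\<in>K. y \<bullet> x = b}"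
    by blast
  have "dim {y \<in> coord_space S. \<forall>x\<in>U. orthogonal x y} + dim U = card S"
    using dim_subspace_orthogonal_to_vectors[OF _ subspace_coord_space U] dim_coord_space[of S]
    by (simp add: U_def)
  moreover have "aff_dim K = int (dim U)"
    unfolding U_def using aff_dim_eq_dim[of a K] hull_inc[OF a] by (metis dim_span)
  ultimately show ?thesis using eq by simp
qed

text \<open>In codimension one that complement is a line.\<close>

lemma facet_equation_unique:
  fixes K :: "(real ^ 'n::finite) set"
  assumes "K \<subseteq> coord_space S" "K \<noteq> {}" "aff_dim K = int (card S) - 1"
    and f: "f \<in> coord_space S" "f \<noteq> 0" "\<And>x. x \<in> K \<Longrightarrow> f \<bullet> x = b"
    and y: "y \<in> coord_space S" "\<And>x. x \<in> K \<Longrightarrow> y \<bullet> x = c"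
  shows "\<exists>t. y = t *\<^sub>R f"
proof -
  let ?W = "{y \<in> coord_space S. \<exists>b. \<forall>x\<in>K. y \<bullet> x = b}"
  have "dim ?W = 1"
    using aff_dim_coord_subset[OF assms(1,2)] assms(3) by simp
  moreover have "{f} \<subseteq> ?W" using f by blast
  moreover have "independent {f}" using f(2) by simp
  ultimately have "?W \<subseteq> span {f}"
    by (intro card_ge_dim_independent) auto
  with y have "y \<in> span {f}" by blast
  then show ?thesis by (auto simp: span_singleton)
qed

lemma aff_dim_ge_two_equations:
  fixes K :: "(real ^ 'n::finite) set"
  assumes "K \<subseteq> coord_space S" "K \<noteq> {}"
    and "\<And>y b. y \<in> coord_space S \<Longrightarrow> (\<And>x. x \<in> K \<Longrightarrow> y \<bullet> x = b) \<Longrightarrow> y \<in> span {f, h}"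
  shows "aff_dim K \<ge> int (card S) - 2"
proof -
  have "{y \<in> coord_space S. \<exists>b. \<forall>x\<in>K. y \<bullet> x = b} \<subseteq> span {f, h}"
    using assms(3) by blast
  then have "dim {y \<in> coord_space S. \<exists>b. \<forall>x\<in>K. y \<bullet> x = b} \<le> card {f, h}"
    by (rule dim_le_card) simp
  also have "\<dots> \<le> 2" by (simp add: card_insert_if)
  finally show ?thesis
    using aff_dim_coord_subset[OF assms(1,2)] by simp
qed

text \<open>Dimension grows strictly along proper inclusions of faces, and nothing fits between a
  facet and \<open>P\<close>. Thus one inclusion suffices to identify a facet.\<close>

lemma facet_subset_proper_face:
  assumes "K facet_of P" "G face_of P" "K \<subseteq> G" "G \<noteq> P" "convex P"
  shows "K = G"
proof (rule ccontr)
  assume "K \<noteq> G"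
  have "K face_of G"
    using assms by (meson face_of_imp_subset face_of_subset facet_of_def)
  then have "aff_dim K < aff_dim G"
    using \<open>K \<noteq> G\<close> assms face_of_aff_dim_lt face_of_imp_convex by blast
  moreover have "aff_dim G < aff_dim P"
    using assms face_of_aff_dim_lt by blast
  ultimately show False using assms(1) by (simp add: facet_of_def)
qed

text \<open>The segment from a relative interior point \<open>a\<close> to \<open>y\<close> leaves
  \<open>P\<close> in some facet. The inequality of that facet is strict at \<open>a\<close> and an
  equality at the exit point, so it fails further on, at \<open>y\<close>. The affine hull condition
  keeps the segment in the range of the relative topology.\<close>

lemma facet_system_violated:
  assumes fs: "facet_system S P \<F>" and "polytope P" and aff: "affine hull P = coord_space S"
    and y: "y \<in> coord_space S" "y \<notin> P"
  shows "\<exists>c\<in>\<F>. fst c \<bullet> y > snd c"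
proof -
  have P: "bounded P" "convex P" "closed P" "polyhedron P"
    using \<open>polytope P\<close> polytope_imp_bounded polytope_imp_convex polytope_imp_closed
      polytope_imp_polyhedron by auto
  have "P \<noteq> {}"
  proof
    assume "P = {}"
    then have "coord_space S = {}" using aff by simp
    then show False using y by simp
  qed
  then obtain a where a: "a \<in> rel_interior P"
    using P rel_interior_eq_empty by blast
  then have aP: "a \<in> P" using rel_interior_subset by blast
  have "a + (y - a) \<in> affine hull P" using aff y by simp
  moreover have "y - a \<noteq> 0" using aP y by auto
  ultimately obtain d where d: "0 < d" "a + d *\<^sub>R (y - a) \<in> rel_frontier P"
    "\<And>e. \<lbrakk>0 \<le> e; e < d\<rbrakk> \<Longrightarrow> a + e *\<^sub>R (y - a) \<in> rel_interior P"
    using ray_to_rel_frontier[OF P(1) a] by metis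
  let ?z = "a + d *\<^sub>R (y - a)"
  have z: "?z \<in> P - rel_interior P"
    using d(2) P(3) by (simp add: rel_frontier_def)
  have "d \<le> 1"
  proof (rule ccontr)
    assume "\<not> d \<le> 1"
    then have "a + 1 *\<^sub>R (y - a) \<in> rel_interior P" by (intro d(3)) auto
    then show False using y rel_interior_subset by auto
  qed
  moreover have "d \<noteq> 1" using z y by auto
  ultimately have "d < 1" by simp
  obtain K where K: "K facet_of P" "?z \<in> K"
    using z rel_boundary_of_polyhedron[OF P(4)] by blast
  then have "K \<in> ineq_face P ` \<F>"
    using fs by (simp add: facet_system_def bij_betw_def)
  then obtain c where c: "c \<in> \<F>" "ineq_face P c = K" by blast
  have fc: "facet_defining S P c" using fs c by (auto simp: facet_system_def)
  have "a \<notin> K"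
  proof -
    have "K face_of P" "K \<noteq> P" using K by (auto simp: facet_of_def)
    then show ?thesis using face_of_disjoint_rel_interior a by blast
  qed
  then have "fst c \<bullet> a < snd c"
    using fc aP c by (fastforce simp: facet_defining_def ineq_face_def)
  moreover have "fst c \<bullet> ?z = snd c" using K c by (auto simp: ineq_face_def)
  then have eq: "fst c \<bullet> a + d * (fst c \<bullet> (y - a)) = snd c"
    by (simp add: inner_add_right)
  ultimately have "d * (fst c \<bullet> (y - a)) > 0" by simp
  then have pos: "fst c \<bullet> (y - a) > 0" using d(1) by (simp add: zero_less_mult_iff)
  have "d * (fst c \<bullet> (y - a)) < 1 * (fst c \<bullet> (y - a))"
    using \<open>d < 1\<close> pos by (intro mult_strict_right_mono) auto
  then have "snd c < fst c \<bullet> y"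
    using eq by (simp add: inner_diff_right)
  then show ?thesis using c by blast
qed

text \<open>Among the subfamilies of \<open>\<F>\<close> with the same integer solutions as
  \<open>P\<close>, an inclusion-minimal one is a minimal formulation, and \<open>y\<close> violates
  one of its members.\<close>

lemma rank_zero_violated:
  assumes fs: "facet_system S P \<F>" and "polytope P" and aff: "affine hull P = coord_space S"
    and conv: "P = convex hull (P \<inter> integer_points S)"
    and y: "y \<in> integer_points S" "y \<notin> P"
  shows "\<exists>h\<in>rank_family S P \<F> 0. fst h \<bullet> y > snd h"
proof -
  let ?sol = "\<lambda>\<M>. solution_set S \<M> \<inter> integer_points S"
  have PS: "P \<subseteq> coord_space S" using aff hull_subset by metis
  have Psol: "P \<subseteq> solution_set S \<M>" if "\<M> \<subseteq> \<F>" for \<M>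
  proof
    fix x assume x: "x \<in> P"
    have "fst c \<bullet> x \<le> snd c" if "c \<in> \<F>" for c
      using fs x that by (auto simp: facet_system_def facet_defining_def)
    then show "x \<in> solution_set S \<M>"
      using x PS \<open>\<M> \<subseteq> \<F>\<close> by (auto simp: solution_set_def)
  qed
  have "solution_set S \<F> \<subseteq> P"
    using facet_system_violated[OF assms(1-3)] unfolding solution_set_def
    by (metis (mono_tags, lifting) mem_Collect_eq not_less subsetI)
  then have full: "?sol \<F> = P \<inter> integer_points S" using Psol by blast
  have "finite \<F>"
    using fs finite_polytope_facets[OF \<open>polytope P\<close>] bij_betw_finite
    by (auto simp: facet_system_def)
  let ?A = "{\<M>. \<M> \<subseteq> \<F> \<and> ?sol \<M> = P \<inter> integer_points S}"
  have "finite ?A" using \<open>finite \<F>\<close> by simp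
  moreover have "\<F> \<in> ?A" using full by simp
  ultimately have "\<exists>\<M>\<in>?A. \<forall>\<N>\<in>?A. \<N> \<subseteq> \<M> \<longrightarrow> \<M> = \<N>"
    by (intro finite_has_minimal) auto
  then obtain \<M> where MA: "\<M> \<in> ?A" and minA: "\<forall>\<N>\<in>?A. \<N> \<subseteq> \<M> \<longrightarrow> \<M> = \<N>" ..
  have M: "\<M> \<subseteq> \<F>" "?sol \<M> = P \<inter> integer_points S" using MA by auto
  have min: "\<M> = \<N>" if "\<N> \<subseteq> \<F>" "?sol \<N> = P \<inter> integer_points S" "\<N> \<subseteq> \<M>" for \<N>
    using minA that by simp
  have "minimal_formulation S P \<F> \<M>"
    unfolding minimal_formulation_def
  proof (intro conjI ballI)
    show "P = convex hull ?sol \<M>" using conv M by simp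
    fix h assume h: "h \<in> \<M>"
    have "P \<inter> integer_points S \<subseteq> ?sol (\<M> - {h})" using Psol[of "\<M> - {h}"] M by blast
    moreover have "?sol (\<M> - {h}) \<noteq> P \<inter> integer_points S"
    proof
      assume "?sol (\<M> - {h}) = P \<inter> integer_points S"
      then have "\<M> = \<M> - {h}" using min[of "\<M> - {h}"] M(1) by auto
      then show False using h by auto
    qed
    ultimately show "P \<inter> integer_points S \<subset> ?sol (\<M> - {h})" by blast
  qed (use M in blast)
  then have rank: "h \<in> rank_family S P \<F> 0" if "h \<in> \<M>" for h
    using that M(1) unfolding rank_family.simps by blast
  have "y \<notin> solution_set S \<M>" using M y by blast
  then obtain h where "h \<in> \<M>" "\<not> fst h \<bullet> y \<le> snd h"
    using y by (auto simp: solution_set_def integer_points_def)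
  then show ?thesis using rank by (meson not_le)
qed

section \<open>The matching polytope\<close>

lemma matching_empty: "matching E {}"
  by (simp add: matching_def)

lemma matching_singleton: "e \<in> E \<Longrightarrow> matching E {e}"
  by (simp add: matching_def)

lemma matching_subset: "matching E M \<Longrightarrow> N \<subseteq> M \<Longrightarrow> matching E N"
  by (auto simp: matching_def intro: pairwise_subset)

lemma incidence_vector_in_polytope:
  "matching E M \<Longrightarrow> incidence_vector M \<in> matching_polytope E"
  unfolding matching_polytope_def by (intro hull_inc) auto

lemma polytope_matching_polytope: "polytope (matching_polytope E)"
  unfolding matching_polytope_def polytope_def
  by (rule exI[of _ "incidence_vector ` {M. matching E M}"]) simp

lemma convex_matching_polytope: "convex (matching_polytope E)"
  by (simp add: matching_polytope_def)

lemma zero_in_matching_polytope: "0 \<in> matching_polytope (E :: 'v::finite set set)"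
proof -
  have "incidence_vector {} = (0 :: real ^ ('v set))"
    by (simp add: incidence_vector_def vec_eq_iff)
  then show ?thesis
    using incidence_vector_in_polytope[OF matching_empty, of E] by metis
qed

lemma coord_space_sum:
  fixes y :: "real ^ 'n::finite"
  assumes "y \<in> coord_space E"
  shows "y = (\<Sum>e\<in>E. y $ e *\<^sub>R incidence_vector {e})"
proof -
  have "(\<Sum>e\<in>E. y $ e *\<^sub>R incidence_vector {e}) $ i = y $ i" for i
  proof -
    have "(\<Sum>e\<in>E. y $ e *\<^sub>R incidence_vector {e}) $ i = (\<Sum>e\<in>E. y $ e * (if i = e then 1 else 0))"
      by (simp add: incidence_vector_def)
    also have "\<dots> = (\<Sum>e\<in>E. if i = e then y $ e else 0)"
      by (rule sum.cong) auto
    also have "\<dots> = y $ i"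
      using assms by (auto simp: coord_space_def)
    finally show ?thesis .
  qed
  then show ?thesis by (simp add: vec_eq_iff)
qed

text \<open>The polytope contains zero and all unit vectors of the coordinates in
  \<open>E\<close>.\<close>

lemma affine_hull_matching_polytope:
  "affine hull (matching_polytope E) = coord_space E"
proof -
  have "span (matching_polytope E) = coord_space E"
  proof
    show "span (matching_polytope E) \<subseteq> coord_space E"
      by (intro span_minimal matching_polytope_subset subspace_coord_space)
    show "coord_space E \<subseteq> span (matching_polytope E)"
    proof
      fix y :: "real ^ 'a set" assume y: "y \<in> coord_space E"
      have "(\<Sum>e\<in>E. y $ e *\<^sub>R incidence_vector {e}) \<in> span (matching_polytope E)"
        by (intro span_sum span_scale span_base incidence_vector_in_polytope matching_singleton)
      then show "y \<in> span (matching_polytope E)" using coord_space_sum[OF y] by simp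
    qed
  qed
  then show ?thesis
    using affine_hull_span_0[of "matching_polytope E"] zero_in_matching_polytope[of E]
    by (simp add: hull_inc)
qed

lemma aff_dim_matching_polytope: "aff_dim (matching_polytope E) = int (card E)"
  by (metis aff_dim_affine_hull affine_hull_matching_polytope aff_dim_subspace
      subspace_coord_space dim_coord_space)

lemma matching_polytope_le:
  assumes "\<And>M. matching E M \<Longrightarrow> (\<Sum>e\<in>M. f $ e) \<le> b" "x \<in> matching_polytope E"
  shows "f \<bullet> x \<le> b"
proof -
  have "matching_polytope E \<subseteq> {x. f \<bullet> x \<le> b}"
    unfolding matching_polytope_def
    using assms(1) by (intro hull_minimal convex_halfspace_le) (auto simp: inner_incidence_vector)
  with assms(2) show ?thesis by blast
qed

text \<open>A face is the convex hull of some of the incidence vectors, so a linear equation need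
  only be checked on matchings.\<close>

lemma face_matching_polytope_eq:
  assumes "K face_of matching_polytope E"
    and "\<And>M. matching E M \<Longrightarrow> incidence_vector M \<in> K \<Longrightarrow> (\<Sum>e\<in>M. f $ e) = b" "x \<in> K"
  shows "f \<bullet> x = b"
proof -
  obtain A where A: "A \<subseteq> incidence_vector ` {M. matching E M}" "K = convex hull A"
    using face_of_convex_hull_subset[of "incidence_vector ` {M. matching E M}" K] assms(1)
    unfolding matching_polytope_def by (metis finite finite_imageI finite_imp_compact)
  have "K \<subseteq> {x. f \<bullet> x = b}"
    unfolding A(2)
  proof (intro hull_minimal convex_hyperplane subsetI)
    fix x assume "x \<in> A"
    moreover have "A \<subseteq> K" using A(2) by (simp add: hull_subset)
    ultimately obtain M where "matching E M" "x = incidence_vector M" "x \<in> K"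
      using A(1) by blast
    with assms(2) show "x \<in> {x. f \<bullet> x = b}" by (simp add: inner_incidence_vector)
  qed
  with assms(3) show ?thesis by blast
qed

lemma face_matching_polytope_nonempty:
  assumes "K face_of matching_polytope E" "K \<noteq> {}"
  shows "\<exists>M. matching E M \<and> incidence_vector M \<in> K"
proof (rule ccontr)
  assume "\<not> ?thesis"
  \<comment> \<open>Without matchings on \<open>K\<close> every equation holds there vacuously, even
    \<open>0 = 1\<close>.\<close>
  then have "0 \<bullet> x = (1 :: real)" if "x \<in> K" for x
    by (intro face_matching_polytope_eq[OF assms(1) _ that]) blast
  with assms(2) show False by auto
qed

lemma matching_polytope_conv_integer:
  "matching_polytope E = convex hull (matching_polytope E \<inter> integer_points E)"
proof
  have "incidence_vector ` {M. matching E M} \<subseteq> matching_polytope E \<inter> integer_points E"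
    using incidence_vector_in_polytope matching_polytope_subset
    by (auto simp: integer_points_def incidence_vector_nth)
  then show "matching_polytope E \<subseteq> convex hull (matching_polytope E \<inter> integer_points E)"
    by (subst matching_polytope_def) (rule hull_mono)
  show "convex hull (matching_polytope E \<inter> integer_points E) \<subseteq> matching_polytope E"
    by (intro hull_minimal convex_matching_polytope) auto
qed

section \<open>Facets described by their tight matchings\<close>

locale matching_facets =
  fixes E :: "'v::finite set set" and \<F> :: "'v set ineq set"
  assumes card2: "\<forall>e\<in>E. card e = 2"
    and facets: "facet_system E (matching_polytope E) \<F>"
begin

abbreviation P where "P \<equiv> matching_polytope E"
abbreviation face where "face \<equiv> ineq_face P"
abbreviation rank_zero where "rank_zero \<equiv> rank_family E P \<F> 0"
abbreviation star where "star v \<equiv> {e \<in> E. v \<in> e}"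

definition tight where
  "tight c M \<longleftrightarrow> matching E M \<and> (\<Sum>e\<in>M. fst c $ e) = snd c"

lemma rank_zero_subset: "rank_zero \<subseteq> \<F>"
  by auto

lemma face_eqD: "c \<in> \<F> \<Longrightarrow> h \<in> \<F> \<Longrightarrow> face c = face h \<Longrightarrow> c = h"
  using facets by (auto simp: facet_system_def bij_betw_def inj_on_def)

lemma facetD:
  assumes "c \<in> \<F>"
  shows "fst c \<in> coord_space E" "face c facet_of P" "face c face_of P" "face c \<noteq> {}"
    "\<And>M. matching E M \<Longrightarrow> (\<Sum>e\<in>M. fst c $ e) \<le> snd c"
proof -
  have c: "facet_defining E P c" using facets assms by (auto simp: facet_system_def)
  then show "fst c \<in> coord_space E" "face c facet_of P" "face c face_of P" "face c \<noteq> {}"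
    by (auto simp: facet_defining_def facet_of_def)
  show "(\<Sum>e\<in>M. fst c $ e) \<le> snd c" if "matching E M" for M
    using c incidence_vector_in_polytope[OF that]
    by (auto simp: facet_defining_def inner_incidence_vector[symmetric])
qed

lemma tight_iff: "matching E M \<Longrightarrow> tight c M \<longleftrightarrow> incidence_vector M \<in> face c"
  using incidence_vector_in_polytope[of E M]
  by (simp add: tight_def ineq_face_def inner_incidence_vector)

lemma tight_exists: "c \<in> \<F> \<Longrightarrow> \<exists>M. tight c M"
  using face_matching_polytope_nonempty[OF facetD(3,4)] tight_iff by metis

lemma zero_le: "c \<in> \<F> \<Longrightarrow> 0 \<le> snd c"
  using facetD(5)[of c "{}"] matching_empty[of E] by simp

lemma face_subset_hyperplane:
  assumes "c \<in> \<F>" "\<And>M. tight c M \<Longrightarrow> (\<Sum>e\<in>M. y $ e) = b" "x \<in> face c"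
  shows "y \<bullet> x = b"
proof (rule face_matching_polytope_eq[OF facetD(3)[OF assms(1)] _ assms(3)])
  fix M assume "matching E M" "incidence_vector M \<in> face c"
  then show "(\<Sum>e\<in>M. y $ e) = b" by (intro assms(2)) (simp add: tight_iff)
qed

lemma facet_equation:
  assumes c: "c \<in> \<F>" and y: "y \<in> coord_space E" "\<And>M. tight c M \<Longrightarrow> (\<Sum>e\<in>M. y $ e) = b"
  shows "\<exists>t. y = t *\<^sub>R fst c"
proof (rule facet_equation_unique)
  show sub: "face c \<subseteq> coord_space E"
    using matching_polytope_subset[of E] by (auto simp: ineq_face_def)
  show "aff_dim (face c) = int (card E) - 1"
    using facetD(2)[OF c] aff_dim_matching_polytope[of E] by (simp add: facet_of_def)
  show "fst c \<noteq> 0"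
  proof
    assume 0: "fst c = 0"
    obtain x where "x \<in> face c" using facetD(4)[OF c] by blast
    then have "snd c = 0" using 0 by (simp add: ineq_face_def)
    then have "face c = P" using 0 by (auto simp: ineq_face_def)
    then show False using facetD(2)[OF c] by (simp add: facet_of_def)
  qed
  show "y \<bullet> x = b" if "x \<in> face c" for x
    using face_subset_hyperplane[OF c y(2) that] by blast
  show "fst c \<bullet> x = snd c" if "x \<in> face c" for x
    using that by (simp add: ineq_face_def)
qed (use facetD(1,4)[OF c] y in auto)

text \<open>Dropping \<open>e\<close> from a tight matching would raise the weight above
  \<open>snd c\<close>. So tight matchings avoid \<open>e\<close>, and the facet lies in a proper
  face, with which it must agree.\<close>

lemma face_negative:
  assumes c: "c \<in> \<F>" and e: "e \<in> E" "fst c $ e < 0"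
  shows "face c = {x \<in> P. incidence_vector {e} \<bullet> x = 0}"
proof (rule facet_subset_proper_face[OF facetD(2)[OF c] _ _ _ convex_matching_polytope])
  have "- incidence_vector {e} \<bullet> x \<le> 0" if "x \<in> P" for x
    by (rule matching_polytope_le[OF _ that]) (auto simp: incidence_vector_nth intro!: sum_nonpos)
  then have "P \<inter> {x. incidence_vector {e} \<bullet> x = 0} face_of P"
    by (intro face_of_Int_supporting_hyperplane_ge convex_matching_polytope) auto
  then show "{x \<in> P. incidence_vector {e} \<bullet> x = 0} face_of P"
    by (simp add: Int_def)
  show "face c \<subseteq> {x \<in> P. incidence_vector {e} \<bullet> x = 0}"
  proof
    fix x assume x: "x \<in> face c"
    have "incidence_vector {e} \<bullet> x = 0"
    proof (rule face_subset_hyperplane[OF c _ x])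
      fix M assume M: "tight c M"
      have "e \<notin> M"
      proof
        assume "e \<in> M"
        then have "(\<Sum>g\<in>M. fst c $ g) = fst c $ e + (\<Sum>g\<in>M - {e}. fst c $ g)"
          by (simp add: sum.remove)
        moreover have "(\<Sum>g\<in>M - {e}. fst c $ g) \<le> snd c"
          using M by (intro facetD(5)[OF c]) (auto simp: tight_def intro: matching_subset)
        ultimately show False using M e by (simp add: tight_def)
      qed
      then show "(\<Sum>g\<in>M. incidence_vector {e} $ g) = 0"
        by (simp add: sum_incidence_vector)
    qed
    then show "x \<in> {x \<in> P. incidence_vector {e} \<bullet> x = 0}"
      using x by (simp add: ineq_face_def)
  qed
  show "{x \<in> P. incidence_vector {e} \<bullet> x = 0} \<noteq> P"
  proof
    assume "{x \<in> P. incidence_vector {e} \<bullet> x = 0} = P"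
    then have "incidence_vector {e} \<bullet> (incidence_vector {e} :: real ^ 'v set) = 0"
      using incidence_vector_in_polytope[OF matching_singleton[OF e(1)]] by blast
    then show False by (simp add: inner_incidence_vector incidence_vector_nth)
  qed
qed

lemma integer_point_violates:
  "y \<in> integer_points E \<Longrightarrow> y \<notin> P \<Longrightarrow> \<exists>h\<in>rank_zero. fst h \<bullet> y > snd h"
  by (rule rank_zero_violated[OF facets polytope_matching_polytope affine_hull_matching_polytope
      matching_polytope_conv_integer])

text \<open>Since \<open>snd h\<close> is nonnegative, an inequality violated at the negative unit
  vector has a negative coefficient at \<open>e\<close>.\<close>

lemma nonneg_rank_zero:
  assumes e: "e \<in> E"
  shows "\<exists>h\<in>rank_zero. face h = {x \<in> P. incidence_vector {e} \<bullet> x = 0}"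
proof -
  let ?y = "- incidence_vector {e} :: real ^ 'v set"
  have "?y \<in> integer_points E"
    using e by (auto simp: integer_points_def coord_space_def incidence_vector_nth)
  moreover have "?y \<notin> P"
  proof
    assume "?y \<in> P"
    then have "- incidence_vector {e} \<bullet> ?y \<le> 0"
      by (rule matching_polytope_le[rotated]) (auto simp: incidence_vector_nth intro!: sum_nonpos)
    then show False by (simp add: inner_incidence_vector incidence_vector_nth)
  qed
  ultimately obtain h where h: "h \<in> rank_zero" "fst h \<bullet> ?y > snd h"
    using integer_point_violates by blast
  then have hF: "h \<in> \<F>" using rank_zero_subset by blast
  have "fst h $ e < 0"
    using h(2) zero_le[OF hF] by (simp add: inner_incidence_vector)
  from face_negative[OF hF e this] h(1) show ?thesis by blast
qed

lemma card_matching_star: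
  assumes "matching E M"
  shows "card (M \<inter> star v) = (if v \<in> \<Union>M then 1 else 0)"
proof (cases "v \<in> \<Union>M")
  case True
  then obtain e where e: "e \<in> M" "v \<in> e" by blast
  have "M \<inter> star v = {e}"
  proof
    show "M \<inter> star v \<subseteq> {e}"
    proof
      fix g assume g: "g \<in> M \<inter> star v"
      then have "\<not> disjnt g e" using e by (auto simp: disjnt_def)
      with assms g e show "g \<in> {e}" by (auto simp: matching_def pairwise_def)
    qed
    show "{e} \<subseteq> M \<inter> star v" using e assms by (auto simp: matching_def)
  qed
  then show ?thesis using True by simp
next
  case False
  then have "M \<inter> star v = {}" by blast
  with False show ?thesis by simp
qed

lemma face_degree:
  assumes c: "c \<in> \<F>" and cov: "\<And>M. tight c M \<Longrightarrow> v \<in> \<Union>M"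
  shows "face c = {x \<in> P. incidence_vector (star v) \<bullet> x = 1}"
proof (rule facet_subset_proper_face[OF facetD(2)[OF c] _ _ _ convex_matching_polytope])
  have "incidence_vector (star v) \<bullet> x \<le> 1" if "x \<in> P" for x
    by (rule matching_polytope_le[OF _ that]) (simp add: sum_incidence_vector card_matching_star)
  then have "P \<inter> {x. incidence_vector (star v) \<bullet> x = 1} face_of P"
    by (intro face_of_Int_supporting_hyperplane_le convex_matching_polytope) auto
  then show "{x \<in> P. incidence_vector (star v) \<bullet> x = 1} face_of P"
    by (simp add: Int_def)
  show "face c \<subseteq> {x \<in> P. incidence_vector (star v) \<bullet> x = 1}"
  proof
    fix x assume x: "x \<in> face c"
    have "incidence_vector (star v) \<bullet> x = 1"
    proof (rule face_subset_hyperplane[OF c _ x])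
      fix M assume M: "tight c M"
      then show "(\<Sum>g\<in>M. incidence_vector (star v) $ g) = 1"
        using cov[OF M] card_matching_star[of M v] by (simp add: sum_incidence_vector tight_def)
    qed
    then show "x \<in> {x \<in> P. incidence_vector (star v) \<bullet> x = 1}"
      using x by (simp add: ineq_face_def)
  qed
  show "{x \<in> P. incidence_vector (star v) \<bullet> x = 1} \<noteq> P"
    using zero_in_matching_polytope[of E] by force
qed

text \<open>Let \<open>h\<close> cut off the path. If a tight \<open>M\<close> missed
  \<open>v\<close>, exchange would show that \<open>M\<close> covers \<open>a\<close> and
  \<open>b\<close> by edges at least as heavy as \<open>{v, a}\<close> and \<open>{v, b}\<close>.
  These are distinct because \<open>a\<close> and \<open>b\<close> are not adjacent, so
  \<open>M\<close> would weigh more than \<open>snd h\<close>. Hence tight matchings cover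
  \<open>v\<close>.\<close>

lemma degree_rank_zero:
  assumes va: "{v, a} \<in> E" and vb: "{v, b} \<in> E" and ab: "a \<noteq> b" "{a, b} \<notin> E"
  shows "\<exists>h\<in>rank_zero. face h = {x \<in> P. incidence_vector (star v) \<bullet> x = 1}"
proof -
  have "card {v, a} = 2" "card {v, b} = 2" using card2 va vb by blast+
  then have neq: "v \<noteq> a" "v \<noteq> b" by auto
  have dif: "{v, a} \<noteq> {v, b}" using ab by (auto simp: doubleton_eq_iff)
  let ?y = "incidence_vector {{v, a}, {v, b}} :: real ^ 'v set"
  have "?y \<in> integer_points E"
    using va vb by (auto simp: integer_points_def incidence_vector_nth intro!: incidence_vector_in_coord_space)
  moreover have "?y \<notin> P"
  proof
    assume "?y \<in> P"
    then have "incidence_vector (star v) \<bullet> ?y \<le> 1"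
      by (rule matching_polytope_le[rotated]) (simp add: sum_incidence_vector card_matching_star)
    moreover have "incidence_vector (star v) \<bullet> ?y = 2"
      using dif va vb by (simp add: inner_incidence_vector incidence_vector_nth)
    ultimately show False by simp
  qed
  ultimately obtain h where h: "h \<in> rank_zero" "fst h \<bullet> ?y > snd h"
    using integer_point_violates by blast
  then have hF: "h \<in> \<F>" using rank_zero_subset by blast
  let ?f = "\<lambda>e. fst h $ e"
  have viol: "?f {v, a} + ?f {v, b} > snd h"
    using h(2) dif by (simp add: inner_incidence_vector)
  have single: "?f e \<le> snd h" if "e \<in> E" for e
    using facetD(5)[OF hF matching_singleton[OF that]] by simp
  have pos: "?f {v, a} > 0" "?f {v, b} > 0"
    using viol single[OF va] single[OF vb] by linarith+
  \<comment> \<open>A negative coefficient would put zero on the facet and force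
    \<open>snd h = 0\<close>, but the single edge \<open>{v, a}\<close> has positive weight.\<close>
  have nonneg: "?f e \<ge> 0" if "e \<in> E" for e
  proof (rule ccontr)
    assume "\<not> ?f e \<ge> 0"
    then have "face h = {x \<in> P. incidence_vector {e} \<bullet> x = 0}"
      using face_negative[OF hF that] by simp
    then have "0 \<in> face h" using zero_in_matching_polytope[of E] by simp
    then have 0: "snd h = 0" by (simp add: ineq_face_def)
    then show False using pos single[OF va] by simp
  qed
  have "v \<in> \<Union>M" if M: "tight h M" for M
  proof (rule ccontr)
    assume v: "v \<notin> \<Union>M"
    have mM: "matching E M" and sM: "sum ?f M = snd h" using M by (auto simp: tight_def)
    note pM = matching_perfect_matching[OF mM]
    have swap: "\<exists>g\<in>M. u \<in> g \<and> ?f {v, u} \<le> ?f g" if u: "{v, u} \<in> E" "?f {v, u} > 0" for u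
    proof -
      have "u \<in> \<Union>M"
      proof (rule ccontr)
        assume "u \<notin> \<Union>M"
        have "sum ?f (insert {v, u} M) \<le> snd h"
          by (rule facetD(5)[OF hF perfect_matching_matching[OF
                perfect_matching_insert[OF pM u(1) v \<open>u \<notin> \<Union>M\<close>]]])
        then show False
          using perfect_matching_sum_insert[OF pM v, of ?f u] sM u(2) by simp
      qed
      then obtain g where g: "g \<in> M" "u \<in> g" by blast
      have p: "perfect_matching E (\<Union>M - g) (M - {g})"
        by (rule perfect_matching_remove[OF pM g(1)])
      have "sum ?f (insert {v, u} (M - {g})) \<le> snd h"
        using v g by (intro facetD(5)[OF hF perfect_matching_matching[OF
                perfect_matching_insert[OF p u(1)]]]) auto
      moreover have "sum ?f (insert {v, u} (M - {g})) = ?f {v, u} + sum ?f (M - {g})"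
        using v by (intro perfect_matching_sum_insert[OF p]) auto
      moreover have "sum ?f M = ?f g + sum ?f (M - {g})"
        using g(1) by (simp add: sum.remove)
      ultimately show ?thesis using g sM by (intro bexI[of _ g]) auto
    qed
    obtain g where g: "g \<in> M" "a \<in> g" "?f {v, a} \<le> ?f g" using swap[OF va pos(1)] by blast
    obtain k where k: "k \<in> M" "b \<in> k" "?f {v, b} \<le> ?f k" using swap[OF vb pos(2)] by blast
    have ME: "M \<subseteq> E" using mM by (simp add: matching_def)
    have "g \<noteq> k"
    proof
      assume "g = k"
      then have "g = {a, b}" using g k ab card2 ME by (intro card_2_eqI) auto
      then show False using g(1) ME ab(2) by blast
    qed
    then have "sum ?f {g, k} = ?f g + ?f k" by simp
    moreover have "sum ?f {g, k} \<le> sum ?f M"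
      using g(1) k(1) ME nonneg by (intro sum_mono2) auto
    ultimately show False using g(3) k(3) viol sM by linarith
  qed
  from face_degree[OF hF this] h(1) show ?thesis by blast
qed

section \<open>Adjacency to facets of rank zero\<close>

text \<open>The upper bound is general, as distinct facets meet in a proper face of each. The lower
  bound comes from counting functionals: those constant on the common matchings lie in the span of
  \<open>p\<close> and \<open>q\<close>.\<close>

lemma adjacent:
  assumes c: "c \<in> \<F>" and h: "h \<in> \<F>" "c \<noteq> h" and ne: "face c \<inter> face h \<noteq> {}"
    and eq: "\<And>y b. y \<in> coord_space E \<Longrightarrow>
      (\<And>M. tight c M \<Longrightarrow> tight h M \<Longrightarrow> (\<Sum>e\<in>M. y $ e) = b) \<Longrightarrow> y \<in> span {p, q}"
  shows "aff_dim (face c \<inter> face h) = aff_dim P - 2"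
proof (rule antisym)
  have "face c \<inter> face h face_of P" using facetD(3) c h by (intro face_of_Int) auto
  then have K: "face c \<inter> face h face_of face c"
    by (rule face_of_subset) (auto simp: ineq_face_def)
  have "face c \<inter> face h \<noteq> face c"
  proof
    assume "face c \<inter> face h = face c"
    then have "face c \<subseteq> face h" by blast
    moreover have "face h \<noteq> P" using facetD(2)[OF h(1)] by (auto simp: facet_of_def)
    ultimately have "face c = face h"
      using facet_subset_proper_face[OF facetD(2)[OF c] facetD(3)[OF h(1)]]
        convex_matching_polytope[of E] by blast
    then show False using face_eqD[OF c h(1)] h(2) by blast
  qed
  then have "aff_dim (face c \<inter> face h) < aff_dim (face c)"
    using face_of_aff_dim_lt[OF _ K] face_of_imp_convex[OF facetD(3)[OF c]] by blast
  then show "aff_dim (face c \<inter> face h) \<le> aff_dim P - 2"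
    using facetD(2)[OF c] by (simp add: facet_of_def)
  have "int (card E) - 2 \<le> aff_dim (face c \<inter> face h)"
  proof (rule aff_dim_ge_two_equations[OF _ ne])
    show "face c \<inter> face h \<subseteq> coord_space E"
      using matching_polytope_subset[of E] by (auto simp: ineq_face_def)
    fix y :: "real ^ 'v set" and b
    assume y: "y \<in> coord_space E" "\<And>x. x \<in> face c \<inter> face h \<Longrightarrow> y \<bullet> x = b"
    show "y \<in> span {p, q}"
    proof (rule eq[OF y(1)])
      fix M assume "tight c M" "tight h M"
      then have "incidence_vector M \<in> face c \<inter> face h"
        using tight_iff by (auto simp: tight_def)
      from y(2)[OF this] show "(\<Sum>e\<in>M. y $ e) = b" by (simp add: inner_incidence_vector)
    qed
  qed
  then show "aff_dim P - 2 \<le> aff_dim (face c \<inter> face h)"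
    by (simp add: aff_dim_matching_polytope)
qed

text \<open>If no edge left \<open>X\<close>, the inner part of one tight matching could be combined
  with the outer part of another, so all inner parts would weigh the same. Restricting
  \<open>fst c\<close> to the edges meeting \<open>X\<close> would give a second, non-proportional
  facet equation.\<close>

lemma support_connected:
  assumes c: "c \<in> \<F>" and pos: "\<And>e. e \<in> E \<Longrightarrow> fst c $ e > 0"
    and X: "X \<subseteq> \<Union>E" "X \<noteq> {}" "X \<noteq> \<Union>E"
  shows "\<exists>e\<in>E. e \<inter> X \<noteq> {} \<and> e \<inter> (\<Union>E - X) \<noteq> {}"
proof (rule ccontr)
  assume "\<not> ?thesis"
  then have no: "e \<subseteq> X" if "e \<in> E" "e \<inter> X \<noteq> {}" for e
    using that by blast
  let ?f = "\<lambda>e. fst c $ e"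
  let ?in = "\<lambda>M. {e \<in> M. e \<inter> X \<noteq> {}}" and ?out = "\<lambda>M. {e \<in> M. e \<inter> X = {}}"
  have split: "sum g M = sum g (?in M) + sum g (?out M)" for g :: "'v set \<Rightarrow> real" and M
    by (subst sum.union_disjoint[symmetric]) (auto intro: sum.cong)
  have le: "sum ?f (?in M) \<le> sum ?f (?in N)" if M: "tight c M" and N: "tight c N" for M N
  proof -
    have m: "matching E (?in M)" "matching E (?out N)"
      using M N by (auto simp: tight_def intro: matching_subset)
    have sub: "\<Union>(?in M) \<subseteq> X" "\<Union>(?out N) \<inter> X = {}"
      using no m(1) by (auto simp: matching_def subset_iff)
    then have disj: "\<Union>(?in M) \<inter> \<Union>(?out N) = {}" by blast
    have "matching E (?in M \<union> ?out N)"
      by (rule perfect_matching_matching[OF perfect_matching_Un[OF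
            matching_perfect_matching[OF m(1)] matching_perfect_matching[OF m(2)] disj]])
    then have "sum ?f (?in M \<union> ?out N) \<le> snd c" by (rule facetD(5)[OF c])
    moreover have "sum ?f (?in M \<union> ?out N) = sum ?f (?in M) + sum ?f (?out N)"
      by (rule perfect_matching_sum_Un[OF
            matching_perfect_matching[OF m(1)] matching_perfect_matching[OF m(2)] disj card2])
    moreover have "sum ?f N = snd c" using N by (simp add: tight_def)
    ultimately show ?thesis using split[of ?f N] by simp
  qed
  define y :: "real ^ 'v set" where "y = (\<chi> e. if e \<inter> X = {} then 0 else fst c $ e)"
  obtain N where N: "tight c N" using tight_exists[OF c] by blast
  have sum_y: "(\<Sum>e\<in>M. y $ e) = sum ?f (?in M)" for M
    by (simp add: y_def sum.If_cases Int_def)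
  have "\<exists>t. y = t *\<^sub>R fst c"
  proof (rule facet_equation[OF c])
    show "y \<in> coord_space E"
      using facetD(1)[OF c] by (auto simp: y_def coord_space_def)
    show "(\<Sum>e\<in>M. y $ e) = sum ?f (?in N)" if "tight c M" for M
      using le[OF that N] le[OF N that] sum_y by simp
  qed
  then obtain t where t: "y = t *\<^sub>R fst c" by blast
  obtain x x' where x: "x \<in> X" and x': "x' \<in> \<Union>E - X" using X by blast
  then obtain e e' where e: "e \<in> E" "x \<in> e" and e': "e' \<in> E" "x' \<in> e'" using X(1) by blast
  have "y $ e = fst c $ e" using x e by (auto simp: y_def)
  then have "t = 1" using t pos[OF e(1)] by simp
  moreover have "e' \<inter> X = {}" using no[OF e'(1)] e' x' by blast
  then have "y $ e' = 0" by (simp add: y_def)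
  then have "t = 0" using t pos[OF e'(1)] by simp
  ultimately show False by simp
qed

text \<open>Here \<open>c\<close> is the degree facet of \<open>v\<close>, and positive coefficients
  force every edge to contain \<open>v\<close>. With two edges the other ends are not adjacent and
  \<open>c\<close> would have rank zero, so only a single edge remains.\<close>

lemma adjacent_star:
  assumes c: "c \<in> \<F>" "c \<notin> rank_zero" and pos: "\<And>e. e \<in> E \<Longrightarrow> fst c $ e > 0"
    and v: "v \<in> \<Union>E" and cov: "\<And>M. tight c M \<Longrightarrow> v \<in> \<Union>M"
  shows "\<exists>h\<in>rank_zero. aff_dim (face c \<inter> face h) = aff_dim P - 2"
proof -
  have fc: "face c = {x \<in> P. incidence_vector (star v) \<bullet> x = 1}"
    by (rule face_degree[OF c(1) cov])
  have "\<exists>t. incidence_vector (star v) = t *\<^sub>R fst c"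
  proof (rule facet_equation[OF c(1)])
    show "incidence_vector (star v) \<in> coord_space E"
      by (rule incidence_vector_in_coord_space) auto
    show "(\<Sum>e\<in>M. incidence_vector (star v) $ e) = 1" if "tight c M" for M
      using cov[OF that] that card_matching_star[of M v]
      by (simp add: sum_incidence_vector tight_def)
  qed
  then obtain t where t: "incidence_vector (star v) = t *\<^sub>R fst c" by blast
  obtain e where e: "e \<in> E" "v \<in> e" using v by blast
  have "(incidence_vector (star v) :: real ^ 'v set) $ e = 1" using e by (simp add: incidence_vector_nth)
  then have "t \<noteq> 0" using t by auto
  have all: "v \<in> g" if "g \<in> E" for g
  proof -
    have "(incidence_vector (star v) :: real ^ 'v set) $ g \<noteq> 0"
      using t \<open>t \<noteq> 0\<close> pos[OF that] by simp
    then show ?thesis by (auto simp: incidence_vector_nth split: if_splits)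
  qed
  have "E = {e}"
  proof (rule ccontr)
    assume "E \<noteq> {e}"
    then obtain g where g: "g \<in> E" "g \<noteq> e" using e by blast
    have ex: "\<exists>a. k = {v, a} \<and> a \<noteq> v" if k: "k \<in> E" for k
    proof -
      have "card k = 2" using card2 k by blast
      then obtain a b where "k = {a, b}" "a \<noteq> b" by (auto simp: card_2_iff)
      then show ?thesis using all[OF k] by (auto simp: insert_commute)
    qed
    obtain a b where ab: "e = {v, a}" "a \<noteq> v" "g = {v, b}" "b \<noteq> v"
      using ex[OF e(1)] ex[OF g(1)] by blast
    then have "a \<noteq> b" "{a, b} \<notin> E" using g all by auto
    then obtain h where h: "h \<in> rank_zero" "face h = face c"
      using degree_rank_zero[of v a b] ab e g fc by metis
    then have "h = c" using face_eqD[of h c] rank_zero_subset c(1) by (metis subsetD)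
    with h(1) c(2) show False by simp
  qed
  obtain h where h: "h \<in> rank_zero" "face h = {x \<in> P. incidence_vector {e} \<bullet> x = 0}"
    using nonneg_rank_zero[OF e(1)] by blast
  have "star v = {e}" using \<open>E = {e}\<close> e by auto
  then have "face c = {x \<in> P. incidence_vector {e} \<bullet> x = 1}" by (simp only: fc)
  then have "face c \<inter> face h = {}" by (auto simp only: h(2))
  \<comment> \<open>The polytope is a segment and its two ends are disjoint facets; the empty set
    has dimension \<open>-1\<close>, which is \<open>card E - 2\<close>.\<close>
  then have "aff_dim (face c \<inter> face h) = aff_dim P - 2"
    using \<open>E = {e}\<close> by (simp add: aff_dim_matching_polytope)
  with h(1) show ?thesis by blast
qed

text \<open>Gallai's lemma makes tight matchings near-perfect, hence equal in size. The all-ones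
  functional is then constant on them, so \<open>fst c\<close> is constant on \<open>E\<close>, and
  conversely every near-perfect matching is tight. Rigidity is the uniqueness of the facet
  equation.\<close>

lemma near_perfect_facet:
  assumes c: "c \<in> \<F>" and pos: "\<And>e. e \<in> E \<Longrightarrow> fst c $ e > 0" and ne: "E \<noteq> {}"
    and missed: "\<And>v. v \<in> \<Union>E \<Longrightarrow> \<exists>M. tight c M \<and> v \<notin> \<Union>M"
  shows "factor_critical E (\<Union>E)" "rigid E (\<Union>E)"
    "\<And>M. tight c M \<longleftrightarrow> (\<exists>v\<in>\<Union>E. perfect_matching E (\<Union>E - {v}) M)"
proof -
  have near: "\<exists>v\<in>\<Union>E. perfect_matching E (\<Union>E - {v}) M" if M: "tight c M" for M
  proof -
    have "\<exists>v\<in>\<Union>E. \<Union>M = \<Union>E - {v}"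
    proof (rule optimal_matching_near_perfect[where f = "\<lambda>e. fst c $ e" and b = "snd c" and E = E])
      show "\<exists>e\<in>E. e \<inter> X \<noteq> {} \<and> e \<inter> (\<Union>E - X) \<noteq> {}"
        if "X \<subseteq> \<Union>E" "X \<noteq> {}" "X \<noteq> \<Union>E" for X
        by (rule support_connected[OF c pos that])
      show "\<exists>M. matching E M \<and> (\<Sum>e\<in>M. fst c $ e) = snd c \<and> v \<notin> \<Union>M" if "v \<in> \<Union>E" for v
        using missed[OF that] by (auto simp: tight_def)
      show "(\<Sum>e\<in>M. fst c $ e) \<le> snd c" if "matching E M" for M
        by (rule facetD(5)[OF c that])
    qed (use card2 pos ne M in \<open>auto simp: tight_def\<close>)
    then show ?thesis using M by (auto simp: tight_def perfect_matching_def)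
  qed
  show fc: "factor_critical E (\<Union>E)"
    unfolding factor_critical_def
  proof
    fix v assume v: "v \<in> \<Union>E"
    then obtain M where M: "tight c M" "v \<notin> \<Union>M" using missed by blast
    obtain u where u: "u \<in> \<Union>E" "perfect_matching E (\<Union>E - {u}) M" using near[OF M(1)] by blast
    have "u = v"
    proof (rule ccontr)
      assume "u \<noteq> v"
      then have "v \<in> \<Union>E - {u}" using v by blast
      then show False using u(2) M(2) by (simp add: perfect_matching_def)
    qed
    with u show "\<exists>M. perfect_matching E (\<Union>E - {v}) M" by blast
  qed
  have card: "2 * card M = card (\<Union>E) - 1"
    if "v \<in> \<Union>E" "perfect_matching E (\<Union>E - {v}) M" for v M
    using perfect_matching_card[OF that(2) card2] that(1) by simp
  have "\<exists>t. incidence_vector E = t *\<^sub>R fst c"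
  proof (rule facet_equation[OF c])
    show "incidence_vector E \<in> coord_space E"
      by (rule incidence_vector_in_coord_space) auto
    show "(\<Sum>e\<in>M. incidence_vector E $ e) = real ((card (\<Union>E) - 1) div 2)" if M: "tight c M" for M
    proof -
      obtain v where "v \<in> \<Union>E" "perfect_matching E (\<Union>E - {v}) M" using near[OF M] by blast
      from card[OF this] have "card M = (card (\<Union>E) - 1) div 2" by simp
      moreover have "M \<inter> E = M" using M by (auto simp: tight_def matching_def)
      ultimately show ?thesis by (simp add: sum_incidence_vector)
    qed
  qed
  then obtain t where t: "incidence_vector E = t *\<^sub>R fst c" by blast
  have t1: "t * fst c $ e = 1" if "e \<in> E" for e
  proof -
    have "(incidence_vector E :: real ^ 'v set) $ e = 1" using that by (simp add: incidence_vector_nth)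
    then show ?thesis using t by simp
  qed
  have "t \<noteq> 0" using t1 ne by fastforce
  have const: "fst c $ e = 1 / t" if "e \<in> E" for e
    using t1[OF that] \<open>t \<noteq> 0\<close> by (simp add: field_simps)
  have weight: "(\<Sum>e\<in>M. fst c $ e) = real (card M) / t" if "matching E M" for M
  proof -
    have "(\<Sum>e\<in>M. fst c $ e) = (\<Sum>e\<in>M. 1 / t)"
      using that by (intro sum.cong) (auto simp: matching_def const)
    then show ?thesis by simp
  qed
  obtain M0 where M0: "tight c M0" using tight_exists[OF c] by blast
  obtain v0 where v0: "v0 \<in> \<Union>E" "perfect_matching E (\<Union>E - {v0}) M0" using near[OF M0] by blast
  have tight: "tight c M" if "v \<in> \<Union>E" "perfect_matching E (\<Union>E - {v}) M" for v M
  proof -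
    have "2 * card M = 2 * card M0" using card[OF that] card[OF v0] by simp
    then have "card M = card M0" by simp
    moreover have "matching E M" "matching E M0"
      using that v0 by (auto simp: perfect_matching_def)
    ultimately show ?thesis using M0 weight by (simp add: tight_def)
  qed
  show "tight c M \<longleftrightarrow> (\<exists>v\<in>\<Union>E. perfect_matching E (\<Union>E - {v}) M)" for M
    using near tight by metis
  show "rigid E (\<Union>E)"
    unfolding rigid_def
  proof (intro allI impI)
    fix \<alpha> :: "'v set \<Rightarrow> real" and \<beta>
    assume \<alpha>: "\<forall>v\<in>\<Union>E. \<forall>M. perfect_matching E (\<Union>E - {v}) M \<longrightarrow> sum \<alpha> M = \<beta>"
    define y :: "real ^ 'v set" where "y = (\<chi> e. if e \<in> E then \<alpha> e else 0)"
    have "\<exists>t. y = t *\<^sub>R fst c"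
    proof (rule facet_equation[OF c])
      show "y \<in> coord_space E" by (simp add: y_def coord_space_def)
      show "(\<Sum>e\<in>M. y $ e) = \<beta>" if M: "tight c M" for M
      proof -
        have "(\<Sum>e\<in>M. y $ e) = sum \<alpha> M"
          using M by (intro sum.cong) (auto simp: y_def tight_def matching_def)
        with near[OF M] \<alpha> show ?thesis by metis
      qed
    qed
    then obtain r where r: "y = r *\<^sub>R fst c" by blast
    have "\<alpha> e = r / t" if "e \<in> E" for e
    proof -
      have "\<alpha> e = y $ e" using that by (simp add: y_def)
      also have "\<dots> = r * fst c $ e" using r by simp
      also have "\<dots> = r / t" using const[OF that] by simp
      finally show ?thesis .
    qed
    then show "\<exists>s. \<forall>e\<in>E. \<alpha> e = s" by blast
  qed
qed

lemma adjacent_near_perfect: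
  assumes c: "c \<in> \<F>" "c \<notin> rank_zero" and ne: "E \<noteq> {}"
    and fc: "factor_critical E (\<Union>E)" and rigid: "rigid E (\<Union>E)"
    and tight: "\<And>M. tight c M \<longleftrightarrow> (\<exists>v\<in>\<Union>E. perfect_matching E (\<Union>E - {v}) M)"
  shows "\<exists>h\<in>rank_zero. aff_dim (face c \<inter> face h) = aff_dim P - 2"
proof -
  \<comment> \<open>A weight with one value on \<open>A\<close> and another off \<open>A\<close>
    combines two incidence vectors, as \<open>adjacent\<close> demands. The set \<open>A\<close>
    will be \<open>{e}\<close> or \<open>star v\<close>.\<close>
  have finish: "\<exists>h\<in>rank_zero. aff_dim (face c \<inter> face h) = aff_dim P - 2"
    if h: "h \<in> rank_zero" and N: "tight c N" "tight h N"
      and A: "A \<subseteq> E"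
      and eq: "\<And>(\<alpha> :: 'v set \<Rightarrow> real) \<beta>. (\<And>M. tight c M \<Longrightarrow> tight h M \<Longrightarrow> sum \<alpha> M = \<beta>) \<Longrightarrow>
        \<exists>s t. \<forall>g\<in>E. \<alpha> g = (if g \<in> A then t else s)" for h N A
  proof (intro bexI[OF _ h] adjacent)
    show "c \<in> \<F>" "h \<in> \<F>" "c \<noteq> h" using c h rank_zero_subset by auto
    have "matching E N" using N by (simp add: tight_def)
    then have "incidence_vector N \<in> face c \<inter> face h" using N tight_iff by blast
    then show "face c \<inter> face h \<noteq> {}" by blast
    fix y :: "real ^ 'v set" and b
    assume y: "y \<in> coord_space E" "\<And>M. tight c M \<Longrightarrow> tight h M \<Longrightarrow> (\<Sum>e\<in>M. y $ e) = b"
    have "\<exists>s t. \<forall>g\<in>E. y $ g = (if g \<in> A then t else s)" by (rule eq) (rule y(2))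
    then obtain s t where st: "\<And>g. g \<in> E \<Longrightarrow> y $ g = (if g \<in> A then t else s)"
      by blast
    have "y = s *\<^sub>R incidence_vector E + (t - s) *\<^sub>R incidence_vector A"
    proof (subst vec_eq_iff, intro allI)
      fix g
      show "y $ g = (s *\<^sub>R incidence_vector E + (t - s) *\<^sub>R incidence_vector A) $ g"
        using st[of g] y(1) A by (cases "g \<in> E") (auto simp: incidence_vector_nth coord_space_def)
    qed
    also have "\<dots> \<in> span {incidence_vector E, incidence_vector A}"
      by (intro span_add span_scale span_base) auto
    finally show "y \<in> span {incidence_vector E, incidence_vector A}" .
  qed
  from factor_critical_last_ear[OF fc rigid card2 refl ne]
  show ?thesis
  proof
    assume "\<exists>e\<in>E. (\<exists>v\<in>\<Union>E. \<exists>M. perfect_matching (E - {e}) (\<Union>E - {v}) M) \<and>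
      (\<forall>(\<alpha> :: 'v set \<Rightarrow> real) \<beta>.
        (\<forall>v\<in>\<Union>E. \<forall>M. perfect_matching (E - {e}) (\<Union>E - {v}) M \<longrightarrow> sum \<alpha> M = \<beta>) \<longrightarrow>
        (\<exists>s. \<forall>g\<in>E - {e}. \<alpha> g = s))"
    then obtain e v N where e: "e \<in> E" and N: "v \<in> \<Union>E" "perfect_matching (E - {e}) (\<Union>E - {v}) N"
      and eq': "\<forall>(\<alpha> :: 'v set \<Rightarrow> real) \<beta>.
        (\<forall>v\<in>\<Union>E. \<forall>M. perfect_matching (E - {e}) (\<Union>E - {v}) M \<longrightarrow> sum \<alpha> M = \<beta>) \<longrightarrow>
        (\<exists>s. \<forall>g\<in>E - {e}. \<alpha> g = s)"
      by (elim bexE conjE exE) (rule that)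
    note eq = eq'[THEN spec, THEN spec, THEN mp]
    obtain h where h: "h \<in> rank_zero" "face h = {x \<in> P. incidence_vector {e} \<bullet> x = 0}"
      using nonneg_rank_zero[OF e] by blast
    have both: "tight c M \<and> tight h M"
      if "v \<in> \<Union>E" "perfect_matching (E - {e}) (\<Union>E - {v}) M" for v M
    proof
      have pm: "perfect_matching E (\<Union>E - {v}) M"
        using that(2) by (rule perfect_matching_mono) auto
      then show "tight c M" using tight that(1) by blast
      have "e \<notin> M" using that(2) by (auto simp: perfect_matching_def matching_def)
      then have "incidence_vector {e} \<bullet> (incidence_vector M :: real ^ 'v set) = 0"
        by (simp add: incidence_vector_inner incidence_vector_nth)
      then show "tight h M"
        using perfect_matching_matching[OF pm] h(2) tight_iff incidence_vector_in_polytope by simp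
    qed
    show ?thesis
    proof (rule finish[OF h(1), of N "{e}"])
      fix \<alpha> :: "'v set \<Rightarrow> real" and \<beta>
      assume const: "\<And>M. tight c M \<Longrightarrow> tight h M \<Longrightarrow> sum \<alpha> M = \<beta>"
      have "\<exists>s. \<forall>g\<in>E - {e}. \<alpha> g = s"
      proof (rule eq, intro ballI allI impI)
        fix v M assume "v \<in> \<Union>E" "perfect_matching (E - {e}) (\<Union>E - {v}) M"
        from both[OF this] show "sum \<alpha> M = \<beta>" by (intro const) auto
      qed
      then obtain s where "\<forall>g\<in>E - {e}. \<alpha> g = s" by blast
      then show "\<exists>s t. \<forall>g\<in>E. \<alpha> g = (if g \<in> {e} then t else s)"
        by (intro exI[of _ s] exI[of _ "\<alpha> e"]) auto
    qed (use both[OF N] e in auto)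
  next
    assume "\<exists>v a b. a \<noteq> b \<and> {v, a} \<in> E \<and> {v, b} \<in> E \<and> {a, b} \<notin> E \<and>
      (\<forall>(\<alpha> :: 'v set \<Rightarrow> real) \<beta>.
        (\<forall>u\<in>\<Union>E - {v}. \<forall>M. perfect_matching E (\<Union>E - {u}) M \<longrightarrow> sum \<alpha> M = \<beta>) \<longrightarrow>
        (\<exists>s t. \<forall>g\<in>E. \<alpha> g = (if v \<in> g then t else s)))"
    then obtain v a b where ab: "a \<noteq> b" "{v, a} \<in> E" "{v, b} \<in> E" "{a, b} \<notin> E"
      and eq': "\<forall>(\<alpha> :: 'v set \<Rightarrow> real) \<beta>.
        (\<forall>u\<in>\<Union>E - {v}. \<forall>M. perfect_matching E (\<Union>E - {u}) M \<longrightarrow> sum \<alpha> M = \<beta>) \<longrightarrow>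
        (\<exists>s t. \<forall>g\<in>E. \<alpha> g = (if v \<in> g then t else s))"
      by (elim exE conjE) (rule that)
    note eq = eq'[THEN spec, THEN spec, THEN mp]
    obtain h where h: "h \<in> rank_zero" "face h = {x \<in> P. incidence_vector (star v) \<bullet> x = 1}"
      using degree_rank_zero[OF ab(2,3,1,4)] by blast
    have both: "tight c M \<and> tight h M"
      if u: "u \<in> \<Union>E - {v}" and M: "perfect_matching E (\<Union>E - {u}) M" for u M
    proof
      show "tight c M" using tight u M by blast
      have "v \<in> \<Union>E - {u}" using u ab(2) by blast
      then have "v \<in> \<Union>M" using M by (simp add: perfect_matching_def)
      have mM: "matching E M" using M by (rule perfect_matching_matching)
      have "incidence_vector (star v) \<bullet> (incidence_vector M :: real ^ 'v set) = 1"
        using card_matching_star[OF mM, of v] \<open>v \<in> \<Union>M\<close>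
        by (simp add: inner_incidence_vector sum_incidence_vector)
      then show "tight h M"
        using mM h(2) tight_iff incidence_vector_in_polytope by simp
    qed
    have "card {v, a} = 2" using card2 ab(2) by blast
    then have a: "a \<in> \<Union>E - {v}" using ab(2) by auto
    then obtain N where N: "perfect_matching E (\<Union>E - {a}) N"
      using fc unfolding factor_critical_def by blast
    show ?thesis
    proof (rule finish[OF h(1), of N "star v"])
      fix \<alpha> :: "'v set \<Rightarrow> real" and \<beta>
      assume const: "\<And>M. tight c M \<Longrightarrow> tight h M \<Longrightarrow> sum \<alpha> M = \<beta>"
      have "\<exists>s t. \<forall>g\<in>E. \<alpha> g = (if v \<in> g then t else s)"
      proof (rule eq, intro ballI allI impI)
        fix u M assume "u \<in> \<Union>E - {v}" "perfect_matching E (\<Union>E - {u}) M"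
        from both[OF this] show "sum \<alpha> M = \<beta>" by (intro const) auto
      qed
      then show "\<exists>s t. \<forall>g\<in>E. \<alpha> g = (if g \<in> star v then t else s)" by simp
    qed (use both[OF a N] in auto)
  qed
qed

lemma adjacent_zero_coefficient:
  assumes c: "c \<in> \<F>" "c \<notin> rank_zero" and e: "e \<in> E" "fst c $ e = 0"
  shows "\<exists>h\<in>rank_zero. aff_dim (face c \<inter> face h) = aff_dim P - 2"
proof -
  obtain h where h: "h \<in> rank_zero" "face h = {x \<in> P. incidence_vector {e} \<bullet> x = 0}"
    using nonneg_rank_zero[OF e(1)] by blast
  have del: "(\<Sum>g\<in>M - {e}. y $ g) = (\<Sum>g\<in>M. y $ g) - (if e \<in> M then y $ e else 0)"
    for y :: "real ^ 'v set" and M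
    by (simp add: sum_diff1)
  have both: "tight c (M - {e}) \<and> tight h (M - {e})" if M: "tight c M" for M
  proof
    have m: "matching E (M - {e})" using M by (auto simp: tight_def intro: matching_subset)
    then show "tight c (M - {e})" using M e by (simp add: tight_def del)
    show "tight h (M - {e})"
      using m h(2) tight_iff incidence_vector_in_polytope[OF m]
      by (simp add: incidence_vector_inner incidence_vector_nth)
  qed
  have "aff_dim (face c \<inter> face h) = aff_dim P - 2"
  proof (rule adjacent)
    show "c \<in> \<F>" "h \<in> \<F>" "c \<noteq> h" using c h rank_zero_subset by auto
    obtain M where "tight c M" using tight_exists[OF c(1)] by blast
    from both[OF this] have "incidence_vector (M - {e}) \<in> face c \<inter> face h"
      using tight_iff by (auto simp: tight_def)
    then show "face c \<inter> face h \<noteq> {}" by blast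
    fix y :: "real ^ 'v set" and b
    assume y: "y \<in> coord_space E" "\<And>M. tight c M \<Longrightarrow> tight h M \<Longrightarrow> (\<Sum>g\<in>M. y $ g) = b"
    \<comment> \<open>Erasing the coefficient at \<open>e\<close> turns the value of
      \<open>y\<close> on \<open>M\<close> into its value on \<open>M - {e}\<close>, so the
      corrected functional is constant on the whole facet of \<open>c\<close>.\<close>
    have "\<exists>t. y - y $ e *\<^sub>R incidence_vector {e} = t *\<^sub>R fst c"
    proof (rule facet_equation[OF c(1)])
      show "y - y $ e *\<^sub>R incidence_vector {e} \<in> coord_space E"
        using y(1) e(1) by (auto simp: coord_space_def incidence_vector_nth)
      show "(\<Sum>g\<in>M. (y - y $ e *\<^sub>R incidence_vector {e}) $ g) = b" if M: "tight c M" for M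
      proof -
        have "(\<Sum>g\<in>M. (y - y $ e *\<^sub>R incidence_vector {e}) $ g) =
          (\<Sum>g\<in>M. y $ g) - y $ e * (\<Sum>g\<in>M. incidence_vector {e} $ g)"
          by (simp add: sum_subtractf sum_distrib_left)
        also have "\<dots> = (\<Sum>g\<in>M - {e}. y $ g)"
          by (auto simp: del sum_incidence_vector)
        also have "\<dots> = b" using both[OF M] y(2) by blast
        finally show ?thesis .
      qed
    qed
    then obtain t where "y - y $ e *\<^sub>R incidence_vector {e} = t *\<^sub>R fst c" by blast
    then have "y = t *\<^sub>R fst c + y $ e *\<^sub>R incidence_vector {e}" by (simp add: algebra_simps)
    moreover have "t *\<^sub>R fst c + y $ e *\<^sub>R incidence_vector {e} \<in> span {fst c, incidence_vector {e}}"
      by (intro span_add span_scale span_base) auto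
    ultimately show "y \<in> span {fst c, incidence_vector {e}}" by simp
  qed
  with h(1) show ?thesis by blast
qed

lemma adjacent_rank_zero:
  assumes c: "c \<in> \<F>" "c \<notin> rank_zero"
  shows "\<exists>h\<in>rank_zero. aff_dim (face c \<inter> face h) = aff_dim P - 2"
proof -
  have nonneg: "fst c $ e \<ge> 0" if e: "e \<in> E" for e
  proof (rule ccontr)
    assume "\<not> ?thesis"
    then have "face c = {x \<in> P. incidence_vector {e} \<bullet> x = 0}"
      using face_negative[OF c(1) e] by simp
    then obtain h where h: "h \<in> rank_zero" "face h = face c"
      using nonneg_rank_zero[OF e] by metis
    then have "h = c" using face_eqD[of h c] rank_zero_subset c(1) by (metis subsetD)
    with h(1) c(2) show False by simp
  qed
  \<comment> \<open>Without edges the polytope is a point; a facet would have dimension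
    \<open>-1\<close>, yet facets are nonempty.\<close>
  have ne: "E \<noteq> {}"
  proof
    assume "E = {}"
    then have "aff_dim (face c) = - 1"
      using facetD(2)[OF c(1)] by (simp add: facet_of_def aff_dim_matching_polytope)
    then show False using facetD(4)[OF c(1)] by (simp add: aff_dim_empty)
  qed
  show ?thesis
  proof (cases "\<exists>e\<in>E. fst c $ e = 0")
    case True
    then show ?thesis using adjacent_zero_coefficient[OF c] by blast
  next
    case False
    have pos: "fst c $ e > 0" if "e \<in> E" for e
      using nonneg[OF that] False that by force
    show ?thesis
    proof (cases "\<exists>v\<in>\<Union>E. \<forall>M. tight c M \<longrightarrow> v \<in> \<Union>M")
      case True
      then obtain v where "v \<in> \<Union>E" "\<And>M. tight c M \<Longrightarrow> v \<in> \<Union>M" by metis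
      with adjacent_star[OF c pos] show ?thesis by blast
    next
      case False
      then have missed: "\<exists>M. tight c M \<and> v \<notin> \<Union>M" if "v \<in> \<Union>E" for v
        using that by metis
      note np = near_perfect_facet[OF c(1) pos ne missed]
      show ?thesis by (rule adjacent_near_perfect[OF c ne np])
    qed
  qed
qed

end

theorem theorem3:
  fixes V :: "'v::finite set" and E :: "'v set set" and \<F> :: "('v set) ineq set"
  assumes "simple_graph V E"
    and "facet_system E (matching_polytope E) \<F>"
  shows "\<exists>\<rho>. has_geometric_rank E (matching_polytope E) \<F> \<rho> \<and> \<rho> \<le> 1"
proof -
  interpret matching_facets E \<F>
    using assms by unfold_locales (auto simp: simple_graph_def)
  let ?F = "rank_family E (matching_polytope E) \<F>"
  have F1: "?F 1 = {c \<in> \<F> - ?F 0. \<exists>h\<in>?F 0. aff_dim (face c \<inter> face h) = aff_dim P - 2}"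
    by (simp only: One_nat_def rank_family.simps(2) atMost_0 UN_insert UN_empty Un_empty_right)
  have U: "(\<Union>i\<in>{..1::nat}. ?F i) = ?F 0 \<union> ?F 1"
  proof -
    have "{..1::nat} = {0, 1}" by auto
    then show ?thesis by (simp only: UN_insert UN_empty Un_empty_right)
  qed
  have "\<F> = ?F 0 \<union> ?F 1"
    unfolding F1 using adjacent_rank_zero rank_zero_subset by blast
  then have all: "\<F> = (\<Union>i\<in>{..1::nat}. ?F i)" using U by simp
  \<comment> \<open>The rank is the least \<open>\<rho>\<close> that exhausts \<open>\<F>\<close>,
    so the value 1 is only correct when \<open>\<F>\<close> differs from its rank-zero part.\<close>
  show ?thesis
  proof (cases "\<F> = ?F 0")
    case True
    then have "has_geometric_rank E P \<F> 0"
      unfolding has_geometric_rank_def by (simp only: atMost_0 UN_insert UN_empty Un_empty_right) simp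
    then show ?thesis by (intro exI[of _ 0]) simp
  next
    case False
    then have "\<F> \<noteq> (\<Union>i\<in>{..\<sigma>}. ?F i)" if "\<sigma> < 1" for \<sigma> :: nat
      using that by (simp only: less_one atMost_0 UN_insert UN_empty Un_empty_right not_False_eq_True)
    with all have "has_geometric_rank E P \<F> 1"
      unfolding has_geometric_rank_def by blast
    then show ?thesis by (intro exI[of _ 1]) simp
  qed
qed

end
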